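(* Let $N$ be a 6-dimensional connected smooth manifold endowed with an $\mathrm{SU}(3)$-structure $(\omega,\psi_+)$. If $(\omega,\psi_+)$ is coupled, then there exists a nonzero real constant $c$ such that $$d\omega = c\,\psi_+.$$ If $(\omega,\psi_+)$ is double, then there exists a nonzero real constant $k$ such that $$d\psi_- = k\,\omega^2.$$
   Context: Stable forms. Let $V$ be a 6-dimensional real vector space. A 2-form $\omega$ on $V$ is stable if and only if $\omega^3\neq 0$. Let $A:\Lambda^5(V^* )\to V\otimes\Lambda^6(V^* )$ be the isomorphism $A(\gamma)=v\otimes\Omega$ where $i_v\Omega=\gamma$. For $\rho\in\Lambda^3(V^* )$ put $K_\rho:V\to V\otimes\Lambda^6(V^* )$, $K_\rho(v)=A((i_v\rho)\wedge\rho)$, and $\lambda(\rho)=\frac16\mathrm{tr}K_\rho^2\in(\Lambda^6(V^* ))^{\otimes 2}$. A 3-form $\rho$ is stable if and only if $\lambda(\rho)\neq 0$. Orient $V$ so that $\omega^3$ is positive, and let $\sqrt{|\lambda(\rho)|}\in\Lambda^6(V^* )$ be the corresponding positive volume form; then $J_\rho=-\frac{1}{\sqrt{|\lambda(\rho)|}}K_\rho$ is an almost complex structure when $\lambda(\rho)<0$. $\mathrm{SU}(3)$-structures. An $\mathrm{SU}(3)$-structure on a 6-dimensional manifold $N$ is a pair $(\omega,\psi_+)$ of a 2-form and a 3-form on $N$ which at each point are stable with $\lambda(\psi_+)<0$, are compatible ($\omega\wedge\psi_+=0$), satisfy the normalization condition $\psi_+\wedge\psi_-=\frac23\omega^3$,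 where $J=J_{\psi_+}$ and $\psi_-=J^*\psi_+$, and are such that $h(\cdot,\cdot)=\omega(\cdot,J\cdot)$ is a Riemannian metric. Here $\omega^2=\omega\wedge\omega$. Classes. An $\mathrm{SU}(3)$-structure is half-flat if $d\psi_+=0$ and $d(\omega^2)=0$. A half-flat $\mathrm{SU}(3)$-structure is coupled if $d\omega=c\,\psi_+$ for some non-vanishing function $c\in C^\infty(N)$, and double (or co-coupled) if $d\psi_-=k\,\omega^2$ for some non-vanishing function $k\in C^\infty(N)$. *)

theory Defs
  imports "HOL-Analysis.Analysis"
begin

section \<open>Smooth maps between open subsets of normed spaces\<close>

primrec Ck_on :: "nat \<Rightarrow> ('e::real_normed_vector \<Rightarrow> 'f::real_normed_vector) \<Rightarrow> 'e set \<Rightarrow> bool" where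
  "Ck_on 0 f S \<longleftrightarrow> continuous_on S f"
| "Ck_on (Suc n) f S \<longleftrightarrow>
     f differentiable_on S \<and> (\<forall>v. Ck_on n (\<lambda>x. frechet_derivative f (at x) v) S)"

text \<open>Only used for open \<open>S\<close> in a finite-dimensional space, where all iterated directional
  derivatives being continuous is the usual meaning of \<open>C\<^sup>\<infinity>\<close>.\<close>

definition smooth_on :: "'e set \<Rightarrow> ('e::real_normed_vector \<Rightarrow> 'f::real_normed_vector) \<Rightarrow> bool" where
  "smooth_on S f \<longleftrightarrow> (\<forall>n. Ck_on n f S)"


section \<open>Smooth manifolds\<close>

text \<open>A chart is a pair of a domain \<open>U\<close> and a coordinate map, of which only the values on \<open>U\<close> matter.\<close>

type_synonym ('a, 'e) chart = "'a set \<times> ('a \<Rightarrow> 'e)"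

abbreviation chart_image :: "('a, 'e) chart \<Rightarrow> 'e set" where
  "chart_image c \<equiv> snd c ` fst c"

abbreviation chart_inv :: "('a, 'e) chart \<Rightarrow> 'e \<Rightarrow> 'a" where
  "chart_inv c \<equiv> inv_into (fst c) (snd c)"

definition is_chart :: "'a topology \<Rightarrow> ('a, 'e::euclidean_space) chart \<Rightarrow> bool" where
  "is_chart X c \<longleftrightarrow> openin X (fst c) \<and> open (chart_image c) \<and>
     homeomorphic_map (subtopology X (fst c)) (top_of_set (chart_image c)) (snd c)"

abbreviation transition :: "('a, 'e) chart \<Rightarrow> ('a, 'e) chart \<Rightarrow> 'e \<Rightarrow> 'e" where
  "transition c c' \<equiv> \<lambda>x. snd c' (chart_inv c x)"

text \<open>The smooth structure is given by an arbitrary (not necessarily maximal) smooth atlas \<open>A\<close>;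
  the dimension is that of the model space \<^typ>\<open>'e\<close>.\<close>

definition smooth_manifold :: "'a topology \<Rightarrow> ('a, 'e::euclidean_space) chart set \<Rightarrow> bool" where
  "smooth_manifold X A \<longleftrightarrow>
     Hausdorff_space X \<and> second_countable X \<and>
     (\<forall>c\<in>A. is_chart X c) \<and> (\<Union>c\<in>A. fst c) = topspace X \<and>
     (\<forall>c\<in>A. \<forall>c'\<in>A. smooth_on (snd c ` (fst c \<inter> fst c')) (transition c c'))"

definition smooth_function :: "('a, 'e::euclidean_space) chart set \<Rightarrow> ('a \<Rightarrow> real) \<Rightarrow> bool" where
  "smooth_function A f \<longleftrightarrow> (\<forall>c\<in>A. smooth_on (chart_image c) (\<lambda>x. f (chart_inv c x)))"


section \<open>Exterior algebra of a vector space\<close>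

text \<open>A \<open>k\<close>-form takes its arguments as a sequence of which only the entries \<open>0, \<dots>, k - 1\<close>
  are used. Wedge product and exterior derivative are normalized so that
  \<open>(dx\<^sub>1 \<and> \<dots> \<and> dx\<^sub>k)(e\<^sub>1, \<dots>, e\<^sub>k) = 1\<close>.\<close>

type_synonym 'v form = "(nat \<Rightarrow> 'v) \<Rightarrow> real"

definition alternating_form :: "nat \<Rightarrow> 'v::real_vector form \<Rightarrow> bool" where
  "alternating_form k \<alpha> \<longleftrightarrow>
     (\<forall>v w. (\<forall>i<k. v i = w i) \<longrightarrow> \<alpha> v = \<alpha> w) \<and>
     (\<forall>v. \<forall>i<k. linear (\<lambda>x. \<alpha> (v(i := x)))) \<and>
     (\<forall>v. \<forall>i<k. \<forall>j<k. i \<noteq> j \<and> v i = v j \<longrightarrow> \<alpha> v = 0)"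

definition wedge :: "nat \<Rightarrow> nat \<Rightarrow> 'v form \<Rightarrow> 'v form \<Rightarrow> 'v form" where
  "wedge k l \<alpha> \<beta> = (\<lambda>v.
     (\<Sum>\<sigma> | \<sigma> permutes {..<k + l}.
        of_int (sign \<sigma>) * \<alpha> (\<lambda>i. v (\<sigma> i)) * \<beta> (\<lambda>i. v (\<sigma> (k + i)))) / (fact k * fact l))"

definition interior_prod :: "'v \<Rightarrow> 'v form \<Rightarrow> 'v form" where
  "interior_prod u \<alpha> = (\<lambda>v. \<alpha> (case_nat u v))"

definition pullback :: "('v \<Rightarrow> 'w) \<Rightarrow> 'w form \<Rightarrow> 'v form" where
  "pullback L \<alpha> = (\<lambda>v. \<alpha> (\<lambda>i. L (v i)))"


section \<open>Stable forms in dimension six\<close>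

text \<open>Elements of \<open>V \<otimes> \<Lambda>\<^sup>6(V\<^sup>*)\<close> are \<open>V\<close>-valued alternating 6-forms, \<open>u \<otimes> \<Omega>\<close> being
  \<open>w \<mapsto> \<Omega>(w) u\<close>; elements of \<open>(\<Lambda>\<^sup>6(V\<^sup>*))\<^sup>\<otimes>\<^sup>2\<close> are functions of two sequences of six vectors.
  \<open>i_iso\<close> is the isomorphism \<open>\<Lambda>\<^sup>5(V\<^sup>*) \<rightarrow> V \<otimes> \<Lambda>\<^sup>6(V\<^sup>*)\<close>; for \<open>\<gamma> \<noteq> 0\<close> the pair \<open>(u, \<Omega>)\<close> with
  \<open>i\<^sub>u \<Omega> = \<gamma>\<close> is unique up to \<open>(t u, \<Omega> / t)\<close> and for \<open>\<gamma> = 0\<close> one has \<open>u \<otimes> \<Omega> = 0\<close>, so \<open>u \<otimes> \<Omega>\<close> is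
  always unique.\<close>

definition i_iso :: "(real^6) form \<Rightarrow> (nat \<Rightarrow> real^6) \<Rightarrow> real^6" where
  "i_iso \<gamma> = (THE T. \<exists>u \<Omega>. alternating_form 6 \<Omega> \<and> interior_prod u \<Omega> = \<gamma> \<and> T = (\<lambda>w. \<Omega> w *\<^sub>R u))"

definition K_map :: "(real^6) form \<Rightarrow> real^6 \<Rightarrow> (nat \<Rightarrow> real^6) \<Rightarrow> real^6" where
  "K_map \<rho> u = i_iso (wedge 2 3 (interior_prod u \<rho>) \<rho>)"

text \<open>The square of \<open>K\<^sub>\<rho>\<close> is the map \<open>V \<rightarrow> V \<otimes> (\<Lambda>\<^sup>6(V\<^sup>*))\<^sup>\<otimes>\<^sup>2\<close>; its trace is the one over \<open>V\<close>.\<close>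

definition lambda :: "(real^6) form \<Rightarrow> (nat \<Rightarrow> real^6) \<Rightarrow> (nat \<Rightarrow> real^6) \<Rightarrow> real" where
  "lambda \<rho> w w' = 1 / 6 * trace (matrix (\<lambda>u. K_map \<rho> (K_map \<rho> u w) w'))"

text \<open>The positive elements of \<open>(\<Lambda>\<^sup>6(V\<^sup>*))\<^sup>\<otimes>\<^sup>2\<close> are the squares \<open>s \<otimes> s\<close> with \<open>s \<noteq> 0\<close>.\<close>

definition lambda_negative :: "(real^6) form \<Rightarrow> bool" where
  "lambda_negative \<rho> \<longleftrightarrow>
     (\<exists>s. alternating_form 6 s \<and> s \<noteq> (\<lambda>_. 0) \<and> (\<forall>w w'. lambda \<rho> w w' = - (s w * s w')))"

definition cube :: "'v form \<Rightarrow> 'v form" where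
  "cube \<omega> = wedge 4 2 (wedge 2 2 \<omega> \<omega>) \<omega>"

definition stable_2form :: "(real^6) form \<Rightarrow> bool" where
  "stable_2form \<omega> \<longleftrightarrow> alternating_form 2 \<omega> \<and> cube \<omega> \<noteq> (\<lambda>_. 0)"

definition stable_3form :: "(real^6) form \<Rightarrow> bool" where
  "stable_3form \<rho> \<longleftrightarrow> alternating_form 3 \<rho> \<and> lambda \<rho> \<noteq> (\<lambda>_ _. 0)"

text \<open>The 6-form \<open>s\<close> with \<open>s(w)\<^sup>2 = \<bar>\<lambda>(\<rho>)(w, w)\<bar>\<close> that is positive for the orientation
  given by \<open>\<omega>\<^sup>3\<close>.\<close>

definition sqrt_abs_lambda :: "(real^6) form \<Rightarrow> (real^6) form \<Rightarrow> (real^6) form" where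
  "sqrt_abs_lambda \<omega> \<rho> = (\<lambda>w. sgn (cube \<omega> w) * sqrt \<bar>lambda \<rho> w w\<bar>)"

text \<open>\<open>J\<^sub>\<rho> u\<close> is determined by \<open>J\<^sub>\<rho> u \<otimes> \<surd>\<bar>\<lambda>(\<rho>)\<bar> = - K\<^sub>\<rho>(u)\<close>.\<close>

definition J_map :: "(real^6) form \<Rightarrow> (real^6) form \<Rightarrow> real^6 \<Rightarrow> real^6" where
  "J_map \<omega> \<rho> u = (THE z. \<forall>w. sqrt_abs_lambda \<omega> \<rho> w *\<^sub>R z = - K_map \<rho> u w)"


section \<open>Differential forms and Riemannian metrics on a manifold\<close>

text \<open>A tangent vector at \<open>p\<close> is represented, for each chart \<open>c\<close> around \<open>p\<close>, by its coordinate
  vector, and the coordinates with respect to two charts are related by the derivative of the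
  transition map. Correspondingly \<open>\<alpha> c p v\<close> is the value at \<open>p\<close> of the differential form \<open>\<alpha>\<close> on the
  tangent vectors whose coordinates in the chart \<open>c\<close> are \<open>v 0, v 1, \<dots>\<close>\<close>

type_synonym ('a, 'e) diff_form = "('a, 'e) chart \<Rightarrow> 'a \<Rightarrow> 'e form"

abbreviation tangent_transition ::
  "('a, 'e::euclidean_space) chart \<Rightarrow> ('a, 'e) chart \<Rightarrow> 'a \<Rightarrow> 'e \<Rightarrow> 'e" where
  "tangent_transition c c' p \<equiv> frechet_derivative (transition c c') (at (snd c p))"

definition is_diff_form ::
  "('a, 'e::euclidean_space) chart set \<Rightarrow> nat \<Rightarrow> ('a, 'e) diff_form \<Rightarrow> bool" where
  "is_diff_form A k \<alpha> \<longleftrightarrow>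
     (\<forall>c\<in>A. \<forall>p\<in>fst c. alternating_form k (\<alpha> c p)) \<and>
     (\<forall>c\<in>A. \<forall>c'\<in>A. \<forall>p\<in>fst c \<inter> fst c'. \<alpha> c p = pullback (tangent_transition c c' p) (\<alpha> c' p)) \<and>
     (\<forall>c\<in>A. \<forall>v. smooth_on (chart_image c) (\<lambda>x. \<alpha> c (chart_inv c x) v))"

text \<open>The values of \<open>\<alpha> c p\<close> are only relevant for charts \<open>c\<close> of the atlas and points \<open>p\<close> in their domain.\<close>

definition diff_form_eq ::
  "('a, 'e) chart set \<Rightarrow> ('a, 'e) diff_form \<Rightarrow> ('a, 'e) diff_form \<Rightarrow> bool" where
  "diff_form_eq A \<alpha> \<beta> \<longleftrightarrow> (\<forall>c\<in>A. \<forall>p\<in>fst c. \<alpha> c p = \<beta> c p)"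

text \<open>In coordinates,
  \<open>(d\<alpha>)(v\<^sub>0, \<dots>, v\<^sub>k) = \<Sum>\<^sub>i (-1)\<^sup>i D\<alpha>(v\<^sub>i)(v\<^sub>0, \<dots>, v\<^sub>i\<^sub>-\<^sub>1, v\<^sub>i\<^sub>+\<^sub>1, \<dots>, v\<^sub>k)\<close> for constant \<open>v\<^sub>i\<close>.\<close>

definition ext_deriv ::
  "nat \<Rightarrow> ('a, 'e::euclidean_space) diff_form \<Rightarrow> ('a, 'e) diff_form" where
  "ext_deriv k \<alpha> = (\<lambda>c p v. \<Sum>i\<le>k. (-1) ^ i *
     frechet_derivative (\<lambda>x. \<alpha> c (chart_inv c x) (\<lambda>j. if j < i then v j else v (Suc j)))
       (at (snd c p)) (v i))"

definition riemannian_metric ::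
  "('a, 'e::euclidean_space) chart set \<Rightarrow> (('a, 'e) chart \<Rightarrow> 'a \<Rightarrow> 'e \<Rightarrow> 'e \<Rightarrow> real) \<Rightarrow> bool" where
  "riemannian_metric A g \<longleftrightarrow>
     (\<forall>c\<in>A. \<forall>p\<in>fst c. bilinear (g c p) \<and> (\<forall>u v. g c p u v = g c p v u) \<and>
        (\<forall>u. u \<noteq> 0 \<longrightarrow> g c p u u > 0)) \<and>
     (\<forall>c\<in>A. \<forall>c'\<in>A. \<forall>p\<in>fst c \<inter> fst c'. \<forall>u v.
        g c p u v = g c' p (tangent_transition c c' p u) (tangent_transition c c' p v)) \<and>
     (\<forall>c\<in>A. \<forall>u v. smooth_on (chart_image c) (\<lambda>x. g c (chart_inv c x) u v))"


section \<open>SU(3)-structures\<close>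

definition psi_minus ::
  "('a, real^6) diff_form \<Rightarrow> ('a, real^6) diff_form \<Rightarrow> ('a, real^6) diff_form" where
  "psi_minus \<omega> \<psi> = (\<lambda>c p. pullback (J_map (\<omega> c p) (\<psi> c p)) (\<psi> c p))"

definition omega_squared :: "('a, 'e) diff_form \<Rightarrow> ('a, 'e) diff_form" where
  "omega_squared \<omega> = (\<lambda>c p. wedge 2 2 (\<omega> c p) (\<omega> c p))"

definition SU3_structure ::
  "('a, real^6) chart set \<Rightarrow> ('a, real^6) diff_form \<Rightarrow> ('a, real^6) diff_form \<Rightarrow> bool" where
  "SU3_structure A \<omega> \<psi> \<longleftrightarrow>
     is_diff_form A 2 \<omega> \<and> is_diff_form A 3 \<psi> \<and>
     (\<forall>c\<in>A. \<forall>p\<in>fst c.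
        stable_2form (\<omega> c p) \<and> stable_3form (\<psi> c p) \<and> lambda_negative (\<psi> c p) \<and>
        wedge 2 3 (\<omega> c p) (\<psi> c p) = (\<lambda>_. 0) \<and>
        wedge 3 3 (\<psi> c p) (psi_minus \<omega> \<psi> c p) = (\<lambda>v. 2 / 3 * cube (\<omega> c p) v)) \<and>
     riemannian_metric A (\<lambda>c p u v. \<omega> c p (case_nat u (\<lambda>_. J_map (\<omega> c p) (\<psi> c p) v)))"

definition half_flat ::
  "('a, real^6) chart set \<Rightarrow> ('a, real^6) diff_form \<Rightarrow> ('a, real^6) diff_form \<Rightarrow> bool" where
  "half_flat A \<omega> \<psi> \<longleftrightarrow> SU3_structure A \<omega> \<psi> \<and>
     diff_form_eq A (ext_deriv 3 \<psi>) (\<lambda>_ _ _. 0) \<and>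
     diff_form_eq A (ext_deriv 4 (omega_squared \<omega>)) (\<lambda>_ _ _. 0)"

definition coupled ::
  "'a topology \<Rightarrow> ('a, real^6) chart set \<Rightarrow> ('a, real^6) diff_form \<Rightarrow> ('a, real^6) diff_form \<Rightarrow> bool"
where
  "coupled X A \<omega> \<psi> \<longleftrightarrow> half_flat A \<omega> \<psi> \<and>
     (\<exists>f. smooth_function A f \<and> (\<forall>p\<in>topspace X. f p \<noteq> 0) \<and>
        diff_form_eq A (ext_deriv 2 \<omega>) (\<lambda>c p v. f p * \<psi> c p v))"

definition double ::
  "'a topology \<Rightarrow> ('a, real^6) chart set \<Rightarrow> ('a, real^6) diff_form \<Rightarrow> ('a, real^6) diff_form \<Rightarrow> bool"
where
  "double X A \<omega> \<psi> \<longleftrightarrow> half_flat A \<omega> \<psi> \<and>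
     (\<exists>f. smooth_function A f \<and> (\<forall>p\<in>topspace X. f p \<noteq> 0) \<and>
        diff_form_eq A (ext_deriv 3 (psi_minus \<omega> \<psi>)) (\<lambda>c p v. f p * omega_squared \<omega> c p v))"

end

theory Submission
  imports Defs
begin

text \<open>Suppose \<open>d\<alpha> = f \<eta>\<close> with \<open>d\<eta> = 0\<close>. Applying \<open>d\<close> once more gives
  \<open>0 = df \<and> \<eta> + f d\<eta> = df \<and> \<eta>\<close>, so \<open>f\<close> is locally constant, and hence constant on a connected
  manifold, as soon as \<open>a \<mapsto> a \<and> \<eta>\<close> is injective on covectors at every point. This is
  \<open>coefficient_constant\<close>. Half-flatness makes both cases instances of it: \<open>\<alpha> = \<omega>\<close> and \<open>\<eta> = \<psi>\<^sub>+\<close>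
  for coupled structures, \<open>\<alpha> = \<psi>\<^sub>-\<close> and \<open>\<eta> = \<omega>\<^sup>2\<close> for double ones.

  The two injectivity statements are pointwise linear algebra, based on the positivity of
  \<open>h(u, u) = \<omega>(u, Ju)\<close>. If \<open>a \<and> \<psi>\<^sub>+ = 0\<close> with \<open>a \<noteq> 0\<close>, then \<open>\<psi>\<^sub>+ = a \<and> \<beta>\<close>, and for \<open>u\<close> in the
  kernel of \<open>a\<close> the form \<open>i\<^sub>u\<psi>\<^sub>+ \<and> \<psi>\<^sub>+\<close> contains \<open>a\<close> twice and vanishes. So \<open>K(u) = 0\<close>, thus
  \<open>J u = 0\<close>, which contradicts \<open>h(u, u) > 0\<close> (\<open>covector_wedge_psi_injective\<close>). If \<open>a \<and> \<omega>\<^sup>2 = 0\<close>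
  with \<open>a \<noteq> 0\<close>, then \<open>\<omega>\<^sup>2\<close> vanishes on the 5-dimensional kernel of \<open>a\<close>; but \<open>\<omega>\<close> has rank 4
  there, and a symplectic basis of a complement of its radical gives a nonzero value of \<open>\<omega>\<^sup>2\<close>
  (\<open>covector_wedge_square_injective\<close>).

  The identity \<open>d d = 0\<close> needs forms with coefficients of class \<open>C\<^sup>2\<close>. For \<open>\<psi>\<^sub>- = J\<^sup>*\<psi>\<^sub>+\<close> this
  is not visible from the definition of \<open>J\<close>, which is pointwise. But \<open>\<omega>\<close> and \<open>h\<close> are smooth and
  \<open>J u\<close> solves the nondegenerate linear system \<open>\<omega>(e\<^sub>i, J u) = h(e\<^sub>i, u)\<close>, so Cramer's rule
  makes it smooth (\<open>Ck_on_psi_minus\<close>).\<close>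

section \<open>Functions of class \<open>C\<^sup>k\<close>\<close>

lemma smooth_on_imp_Ck_on: "smooth_on S f \<Longrightarrow> Ck_on n f S"
  by (simp add: smooth_on_def)

lemma Ck_on_cong:
  fixes f g :: "'e::real_normed_vector \<Rightarrow> 'f::real_normed_vector"
  assumes "open S" "\<And>x. x \<in> S \<Longrightarrow> f x = g x"
  shows "Ck_on n f S \<longleftrightarrow> Ck_on n g S"
  using assms(2)
proof (induction n arbitrary: f g)
  case 0
  then show ?case by (simp cong: continuous_on_cong)
next
  case (Suc n)
  have imp: "Ck_on (Suc n) g' S"
    if C: "Ck_on (Suc n) f' S" and eq: "\<And>x. x \<in> S \<Longrightarrow> f' x = g' x" for f' g' :: "'e \<Rightarrow> 'f"
  proof -
    have d: "f' differentiable_on S" and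
      D: "\<And>v. Ck_on n (\<lambda>x. frechet_derivative f' (at x) v) S"
      using C by auto
    have eqD: "frechet_derivative f' (at x) = frechet_derivative g' (at x)" if "x \<in> S" for x
      using frechet_derivative_transform_within_open[of f' x S g'] d eq that assms(1)
      by (auto simp: differentiable_on_eq_differentiable_at)
    have "Ck_on n (\<lambda>x. frechet_derivative f' (at x) v) S \<longleftrightarrow>
        Ck_on n (\<lambda>x. frechet_derivative g' (at x) v) S" for v
      by (rule Suc.IH) (simp add: eqD)
    moreover have "g' differentiable_on S"
      using d eq differentiable_on_eq_differentiable_at[OF assms(1)]
      by (metis differentiable_on_def differentiable_transform_within zero_less_one)
    ultimately show ?thesis using D by simp
  qed
  show ?case using imp[of f g] imp[of g f] Suc.prems by metis
qed

lemma Ck_on_SucD: "Ck_on (Suc n) f S \<Longrightarrow> Ck_on n f S"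
proof (induction n arbitrary: f)
  case 0
  then show ?case by (simp add: differentiable_imp_continuous_on)
next
  case (Suc n)
  then show ?case by (metis Ck_on.simps(2))
qed

lemma Ck_on_Suc_differentiable:
  assumes "open S" "Ck_on (Suc n) f S" "x \<in> S"
  shows "f differentiable (at x)"
  using assms by (auto simp: differentiable_on_eq_differentiable_at)

text \<open>The rules for sums, products and inverses rest on this one. Membership in \<open>C\<^sup>k\<close> depends
  only on the values on \<open>S\<close>, so a formula for the derivative there can take the place of
  \<open>frechet_derivative\<close>.\<close>

lemma Ck_on_SucI:
  assumes S: "open S"
    and der: "\<And>x. x \<in> S \<Longrightarrow> (f has_derivative D x) (at x)"
    and D: "\<And>v. Ck_on n (\<lambda>x. D x v) S"
  shows "Ck_on (Suc n) f S"
proof -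
  have "f differentiable_on S"
    using der by (auto simp: differentiable_on_eq_differentiable_at[OF S] differentiable_def)
  moreover have "Ck_on n (\<lambda>x. frechet_derivative f (at x) v) S" for v
    using D[of v] frechet_derivative_at[OF der]
    by (subst Ck_on_cong[OF S, of _ "\<lambda>x. D x v"]) auto
  ultimately show ?thesis by simp
qed

lemma Ck_on_const: "Ck_on n (\<lambda>x. c) S"
  by (induction n arbitrary: c) auto

lemma Ck_on_add:
  assumes S: "open S"
  shows "Ck_on n f S \<Longrightarrow> Ck_on n g S \<Longrightarrow> Ck_on n (\<lambda>x. f x + g x) S"
proof (induction n arbitrary: f g)
  case 0
  then show ?case by (simp add: continuous_on_add)
next
  case (Suc n)
  note d = Ck_on_Suc_differentiable[OF S, THEN frechet_derivative_works[THEN iffD1]]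
  show ?case
    by (rule Ck_on_SucI[OF S has_derivative_add[OF d[OF Suc.prems(1)] d[OF Suc.prems(2)]]])
      (use Suc in auto)
qed

lemma Ck_on_mult:
  fixes f g :: "'e::real_normed_vector \<Rightarrow> real"
  assumes S: "open S"
  shows "Ck_on n f S \<Longrightarrow> Ck_on n g S \<Longrightarrow> Ck_on n (\<lambda>x. f x * g x) S"
proof (induction n arbitrary: f g)
  case 0
  then show ?case by (simp add: continuous_on_mult)
next
  case (Suc n)
  note d = Ck_on_Suc_differentiable[OF S, THEN frechet_derivative_works[THEN iffD1]]
  have "Ck_on n f S" "Ck_on n g S"
    using Suc.prems by (auto intro: Ck_on_SucD simp del: Ck_on.simps)
  then show ?case
    by (intro Ck_on_SucI[OF S has_derivative_mult[OF d[OF Suc.prems(1)] d[OF Suc.prems(2)]]]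
          Ck_on_add[OF S] Suc.IH) (use Suc.prems in auto)
qed

lemma Ck_on_inverse:
  fixes f :: "'e::real_normed_vector \<Rightarrow> real"
  assumes S: "open S" and nz: "\<And>x. x \<in> S \<Longrightarrow> f x \<noteq> 0"
  shows "Ck_on n f S \<Longrightarrow> Ck_on n (\<lambda>x. inverse (f x)) S"
proof (induction n)
  case 0
  then show ?case using nz by (simp add: continuous_on_inverse)
next
  case (Suc n)
  note d = Ck_on_Suc_differentiable[OF S Suc.prems, THEN frechet_derivative_works[THEN iffD1]]
  have inv: "Ck_on n (\<lambda>x. inverse (f x)) S"
    using Suc by (auto intro: Ck_on_SucD simp del: Ck_on.simps)
  have "Ck_on n (\<lambda>x. (- 1) * (inverse (f x) * frechet_derivative f (at x) v * inverse (f x))) S"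
    for v
    by (intro Ck_on_mult[OF S] Ck_on_const inv) (use Suc.prems in auto)
  then have "Ck_on n (\<lambda>x. - (inverse (f x) * frechet_derivative f (at x) v * inverse (f x))) S"
    for v by simp
  then show ?case
    by (intro Ck_on_SucI[OF S Deriv.has_derivative_inverse[OF nz d]])
qed

lemma Ck_on_sum:
  assumes S: "open S"
  shows "(\<And>i. i \<in> I \<Longrightarrow> Ck_on n (f i) S) \<Longrightarrow> Ck_on n (\<lambda>x. \<Sum>i\<in>I. f i x) S"
  by (induction I rule: infinite_finite_induct) (auto intro: Ck_on_const Ck_on_add[OF S])

lemma Ck_on_prod:
  fixes f :: "'i \<Rightarrow> 'e::real_normed_vector \<Rightarrow> real"
  assumes S: "open S"
  shows "(\<And>i. i \<in> I \<Longrightarrow> Ck_on n (f i) S) \<Longrightarrow> Ck_on n (\<lambda>x. \<Prod>i\<in>I. f i x) S"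
  by (induction I rule: infinite_finite_induct) (auto intro: Ck_on_const Ck_on_mult[OF S])

lemma Ck_on_det:
  fixes M :: "'e::real_normed_vector \<Rightarrow> real^'n^'n"
  assumes "open S" "\<And>i j. Ck_on n (\<lambda>x. M x $ i $ j) S"
  shows "Ck_on n (\<lambda>x. det (M x)) S"
  unfolding det_def
  by (intro Ck_on_sum Ck_on_mult Ck_on_const Ck_on_prod assms)

text \<open>By Cramer's rule the solution of a linear system is a quotient of determinants, which are
  polynomials in the coefficients.\<close>

lemma Ck_on_solution_of_linear_system:
  fixes M :: "'e::real_normed_vector \<Rightarrow> real^'n^'n"
  assumes S: "open S"
    and M: "\<And>i j. Ck_on n (\<lambda>x. M x $ i $ j) S"
    and b: "\<And>i. Ck_on n (\<lambda>x. b x $ i) S"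
    and inj: "\<And>x u. x \<in> S \<Longrightarrow> M x *v u = 0 \<Longrightarrow> u = 0"
    and sol: "\<And>x. x \<in> S \<Longrightarrow> M x *v z x = b x"
  shows "Ck_on n (\<lambda>x. z x $ k) S"
proof -
  have det: "det (M x) \<noteq> 0" if "x \<in> S" for x
    using inj[OF that] by (metis invertible_det_nz invertible_left_inverse matrix_left_invertible_ker)
  have "z x $ k = det (\<chi> i j. if j = k then b x $ i else M x $ i $ j) * inverse (det (M x))"
    if "x \<in> S" for x
    using cramer[OF det[OF that], of "z x" "b x"] sol[OF that] by (simp add: divide_inverse)
  moreover have "Ck_on n (\<lambda>x. (\<chi> i j. if j = k then b x $ i else M x $ i $ j) $ i $ j) S" for i j
    by (cases "j = k") (simp_all add: M b)
  then have "Ck_on n (\<lambda>x. det (\<chi> i j. if j = k then b x $ i else M x $ i $ j) * inverse (det (M x))) S"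
    by (intro Ck_on_mult[OF S] Ck_on_det[OF S] Ck_on_inverse[OF S] det M)
  ultimately show ?thesis
    by (subst Ck_on_cong[OF S]) auto
qed

section \<open>Symmetry of second derivatives\<close>

lemma mean_value_on_segment:
  fixes g :: "'e::real_normed_vector \<Rightarrow> real"
  assumes h: "0 < h"
    and g: "\<And>t. 0 \<le> t \<Longrightarrow> t \<le> h \<Longrightarrow> g differentiable (at (y + t *\<^sub>R u))"
  obtains t where "0 < t" "t < h" "g (y + h *\<^sub>R u) - g y = h * frechet_derivative g (at (y + t *\<^sub>R u)) u"
proof -
  have "((\<lambda>t. g (y + t *\<^sub>R u)) has_derivative
          (\<lambda>s. frechet_derivative g (at (y + t *\<^sub>R u)) (s *\<^sub>R u))) (at t)" if "0 \<le> t" "t \<le> h" for t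
    using g[OF that] unfolding frechet_derivative_works
    by (rule has_derivative_compose[rotated, where f = "\<lambda>t. y + t *\<^sub>R u"])
      (auto intro!: derivative_eq_intros)
  moreover have "frechet_derivative g (at (y + t *\<^sub>R u)) (s *\<^sub>R u) =
      frechet_derivative g (at (y + t *\<^sub>R u)) u * s" if "0 \<le> t" "t \<le> h" for t s
    using g[OF that] by (simp add: linear_frechet_derivative linear_cmul)
  ultimately have "DERIV (\<lambda>t. g (y + t *\<^sub>R u)) t :> frechet_derivative g (at (y + t *\<^sub>R u)) u"
    if "0 \<le> t" "t \<le> h" for t
    using that by (simp add: has_field_derivative_def mult_commute_abs)
  from MVT2[OF h this] show ?thesis using that by auto
qed

text \<open>The second difference of \<open>g\<close> over a parallelogram with sides \<open>h u\<close> and \<open>h v\<close> is \<open>h\<^sup>2\<close>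
  times a value of \<open>D\<^sub>v D\<^sub>u g\<close> inside it: the mean value theorem applies first in direction \<open>u\<close>
  to \<open>g(\<cdot> + h v) - g\<close> and then in direction \<open>v\<close> to \<open>D\<^sub>u g\<close>.\<close>

lemma symmetric_second_derivative_approx:
  fixes g :: "'e::real_normed_vector \<Rightarrow> real"
  assumes S: "open S" and g: "Ck_on 2 g S" and h: "0 < h"
    and sub: "\<And>s t. 0 \<le> s \<Longrightarrow> s \<le> h \<Longrightarrow> 0 \<le> t \<Longrightarrow> t \<le> h \<Longrightarrow> x + s *\<^sub>R u + t *\<^sub>R v \<in> S"
  obtains s t where "0 < s" "s < h" "0 < t" "t < h"
    "g (x + h *\<^sub>R u + h *\<^sub>R v) - g (x + h *\<^sub>R u) - g (x + h *\<^sub>R v) + g x =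
       h * (h * frechet_derivative (\<lambda>y. frechet_derivative g (at y) u) (at (x + s *\<^sub>R u + t *\<^sub>R v)) v)"
proof -
  have g1: "Ck_on (Suc 1) g S" and g2: "Ck_on (Suc 0) (\<lambda>y. frechet_derivative g (at y) w) S" for w
    using g by (simp_all add: numeral_2_eq_2)
  note d1 = Ck_on_Suc_differentiable[OF S g1]
  note d2 = Ck_on_Suc_differentiable[OF S g2]
  define F where "F y = g (y + h *\<^sub>R v) - g y" for y
  have F: "(F has_derivative (\<lambda>w. frechet_derivative g (at (y + h *\<^sub>R v)) w -
      frechet_derivative g (at y) w)) (at y)" if "y \<in> S" "y + h *\<^sub>R v \<in> S" for y
  proof -
    have "((\<lambda>y. g (y + h *\<^sub>R v)) has_derivative
            (\<lambda>w. frechet_derivative g (at (y + h *\<^sub>R v)) w)) (at y)"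
      by (rule has_derivative_compose[where f = "\<lambda>y. y + h *\<^sub>R v"
            and g' = "frechet_derivative g (at (y + h *\<^sub>R v))"])
        (use d1[OF that(2)] in \<open>auto intro!: derivative_eq_intros simp: frechet_derivative_works\<close>)
    then show ?thesis
      unfolding F_def using d1[OF that(1)]
      by (intro has_derivative_diff) (auto simp: frechet_derivative_works)
  qed
  have in_S: "x + t *\<^sub>R u \<in> S" "x + t *\<^sub>R u + h *\<^sub>R v \<in> S" if "0 \<le> t" "t \<le> h" for t
    using sub[of t 0] sub[of t h] that h by auto
  have "F differentiable (at (x + t *\<^sub>R u))" if "0 \<le> t" "t \<le> h" for t
    using F[OF in_S[OF that]] by (auto simp: differentiable_def)
  from mean_value_on_segment[OF h this]
  obtain s where s: "0 < s" "s < h"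
    "F (x + h *\<^sub>R u) - F x = h * frechet_derivative F (at (x + s *\<^sub>R u)) u" by auto
  define G where "G = (\<lambda>y. frechet_derivative g (at y) u)"
  have "frechet_derivative F (at (x + s *\<^sub>R u)) u = G (x + s *\<^sub>R u + h *\<^sub>R v) - G (x + s *\<^sub>R u)"
    using fun_cong[OF frechet_derivative_at[OF F[OF in_S[of s]]], of u] s(1,2) by (simp add: G_def)
  moreover have "G differentiable (at (x + s *\<^sub>R u + t *\<^sub>R v))" if "0 \<le> t" "t \<le> h" for t
    unfolding G_def using sub[of s t] s(1,2) that by (intro d2) auto
  from mean_value_on_segment[OF h this]
  obtain t where "0 < t" "t < h" "G (x + s *\<^sub>R u + h *\<^sub>R v) - G (x + s *\<^sub>R u) =
      h * frechet_derivative G (at (x + s *\<^sub>R u + t *\<^sub>R v)) v" by auto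
  ultimately show ?thesis
    using s that[of s t] by (simp add: F_def G_def algebra_simps)
qed

text \<open>The second difference is symmetric in \<open>u\<close> and \<open>v\<close>, so values of \<open>D\<^sub>v D\<^sub>u g\<close> and
  \<open>D\<^sub>u D\<^sub>v g\<close> at two points near \<open>x\<close> agree; both are continuous at \<open>x\<close>.\<close>

lemma symmetric_second_derivative:
  fixes g :: "'e::real_normed_vector \<Rightarrow> real"
  assumes S: "open S" and g: "Ck_on 2 g S" and x: "x \<in> S"
  shows "frechet_derivative (\<lambda>y. frechet_derivative g (at y) u) (at x) v =
         frechet_derivative (\<lambda>y. frechet_derivative g (at y) v) (at x) u"
proof -
  define P where "P u v y = frechet_derivative (\<lambda>y. frechet_derivative g (at y) u) (at y) v" for u v y
  have cont: "continuous (at x) (P u v)" for u v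
    using g S x by (auto simp: P_def[abs_def] numeral_2_eq_2 continuous_on_eq_continuous_at)
  have "\<bar>P u v x - P v u x\<bar> \<le> 0 + e" if "0 < e" for e :: real
  proof -
    have e2: "e / 2 > 0" using that by simp
    obtain d1 where d1: "d1 > 0" "\<And>y. dist y x < d1 \<Longrightarrow> \<bar>P u v y - P u v x\<bar> < e / 2"
      using cont[of u v] e2 unfolding continuous_at_eps_delta dist_real_def by metis
    obtain d2 where d2: "d2 > 0" "\<And>y. dist y x < d2 \<Longrightarrow> \<bar>P v u y - P v u x\<bar> < e / 2"
      using cont[of v u] e2 unfolding continuous_at_eps_delta dist_real_def by metis
    obtain d3 where d3: "d3 > 0" "\<And>y. dist y x < d3 \<Longrightarrow> y \<in> S"
      using S x unfolding open_dist by metis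
    define d where "d = Min {d1, d2, d3}"
    have d: "d > 0" "d \<le> d1" "d \<le> d2" "d \<le> d3" using d1 d2 d3 by (auto simp: d_def)
    \<comment> \<open>With this scale the whole parallelogram lies within distance \<open>d\<close> of \<open>x\<close>.\<close>
    define h where "h = d / (2 * (norm u + norm v + 1))"
    have nn: "norm u + norm v + 1 > 0" using norm_ge_zero[of u] norm_ge_zero[of v] by linarith
    have h: "h > 0" using d nn by (simp add: h_def)
    have near: "dist (x + s *\<^sub>R u + t *\<^sub>R v) x < d" if "0 \<le> s" "s \<le> h" "0 \<le> t" "t \<le> h" for s t
    proof -
      have "dist (x + s *\<^sub>R u + t *\<^sub>R v) x = norm (s *\<^sub>R u + t *\<^sub>R v)"
        by (simp add: dist_norm add.assoc)
      also have "\<dots> \<le> s * norm u + t * norm v"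
        using that norm_triangle_ineq[of "s *\<^sub>R u" "t *\<^sub>R v"] by simp
      also have "\<dots> \<le> h * norm u + h * norm v"
        using that by (intro add_mono mult_right_mono) auto
      also have "\<dots> < h * (2 * (norm u + norm v + 1))"
        using h mult_pos_pos[OF h nn] by (simp add: algebra_simps)
      also have "\<dots> = d" using nn by (simp add: h_def)
      finally show ?thesis .
    qed
    have near': "dist (x + s *\<^sub>R v + t *\<^sub>R u) x < d" if "0 \<le> s" "s \<le> h" "0 \<le> t" "t \<le> h" for s t
      using near[of t s] that by (simp add: algebra_simps)
    have in_S: "x + s *\<^sub>R u + t *\<^sub>R v \<in> S" and in_S': "x + s *\<^sub>R v + t *\<^sub>R u \<in> S"
      if "0 \<le> s" "s \<le> h" "0 \<le> t" "t \<le> h" for s t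
      using near[OF that] near'[OF that] d(4) d3(2) by auto
    obtain s t where st: "0 < s" "s < h" "0 < t" "t < h"
      "g (x + h *\<^sub>R u + h *\<^sub>R v) - g (x + h *\<^sub>R u) - g (x + h *\<^sub>R v) + g x =
         h * (h * P u v (x + s *\<^sub>R u + t *\<^sub>R v))"
      using symmetric_second_derivative_approx[OF S g h in_S, folded P_def] by blast
    obtain s' t' where st': "0 < s'" "s' < h" "0 < t'" "t' < h"
      "g (x + h *\<^sub>R v + h *\<^sub>R u) - g (x + h *\<^sub>R v) - g (x + h *\<^sub>R u) + g x =
         h * (h * P v u (x + s' *\<^sub>R v + t' *\<^sub>R u))"
      using symmetric_second_derivative_approx[OF S g h in_S', folded P_def] by blast
    have "h * (h * P u v (x + s *\<^sub>R u + t *\<^sub>R v)) = h * (h * P v u (x + s' *\<^sub>R v + t' *\<^sub>R u))"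
      unfolding st(5)[symmetric] st'(5)[symmetric] by (simp add: algebra_simps)
    then have "P u v (x + s *\<^sub>R u + t *\<^sub>R v) = P v u (x + s' *\<^sub>R v + t' *\<^sub>R u)" using h by simp
    moreover have "\<bar>P u v (x + s *\<^sub>R u + t *\<^sub>R v) - P u v x\<bar> < e / 2"
      using near[of s t] st d by (intro d1) auto
    moreover have "\<bar>P v u (x + s' *\<^sub>R v + t' *\<^sub>R u) - P v u x\<bar> < e / 2"
      using near'[of s' t'] st' d by (intro d2) auto
    ultimately show ?thesis by linarith
  qed
  then have "\<bar>P u v x - P v u x\<bar> \<le> 0" by (rule field_le_epsilon)
  then show ?thesis by (simp add: P_def)
qed


section \<open>The exterior derivative in a chart\<close>

definition omit :: "nat \<Rightarrow> (nat \<Rightarrow> 'v) \<Rightarrow> nat \<Rightarrow> 'v" where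
  "omit i v = (\<lambda>j. if j < i then v j else v (Suc j))"

lemma omit_omit: "i < j \<Longrightarrow> omit i (omit j v) = omit (j - 1) (omit i v)"
  by (auto simp: omit_def fun_eq_iff)

text \<open>The exterior derivative of a form on an open subset of a vector space. Working with it
  keeps charts out of the proof of \<open>d d = 0\<close>.\<close>

definition local_d :: "nat \<Rightarrow> ('e::real_normed_vector \<Rightarrow> 'e form) \<Rightarrow> 'e \<Rightarrow> 'e form" where
  "local_d k \<beta> x v = (\<Sum>i\<le>k. (-1) ^ i * frechet_derivative (\<lambda>y. \<beta> y (omit i v)) (at x) (v i))"

text \<open>The wedge product \<open>a \<and> \<eta>\<close> of a covector with a \<open>k\<close>-form, expanded along \<open>a\<close>. This is the
  shape in which the product rule for \<open>local_d\<close> yields \<open>df \<and> \<eta>\<close>.\<close>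

definition covector_wedge :: "nat \<Rightarrow> ('v \<Rightarrow> real) \<Rightarrow> 'v form \<Rightarrow> 'v form" where
  "covector_wedge k a \<eta> v = (\<Sum>i\<le>k. (-1) ^ i * a (v i) * \<eta> (omit i v))"

lemma ext_deriv_eq_local_d:
  "ext_deriv k \<alpha> c p v = local_d k (\<lambda>x. \<alpha> c (chart_inv c x)) (snd c p) v"
  by (simp add: ext_deriv_def local_d_def omit_def)

text \<open>The combinatorial core of \<open>d d = 0\<close>. Removing the arguments with indices \<open>i < j\<close> in
  either order leaves the same sequence, but removing \<open>i\<close> first moves \<open>j\<close> to position \<open>j - 1\<close>
  and so changes the sign.\<close>

lemma sum_omit_pairs_eq_0:
  fixes P :: "(nat \<Rightarrow> 'v) \<Rightarrow> 'v \<Rightarrow> 'v \<Rightarrow> real"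
  assumes sym: "\<And>w x y. P w x y = P w y x"
  shows "(\<Sum>j\<le>Suc k. (-1) ^ j * (\<Sum>i\<le>k. (-1) ^ i * P (omit i (omit j v)) (omit j v i) (v j))) = 0"
proof -
  define t where "t = (\<lambda>(j, i). (-1) ^ j * ((-1) ^ i * P (omit i (omit j v)) (omit j v i) (v j)))"
  \<comment> \<open>\<open>A\<close>: the smaller index is removed second; \<open>B\<close>: it is removed first.\<close>
  define A B where "A = {(j, i). i < j \<and> j \<le> Suc k}" and "B = {(j, i). j \<le> i \<and> i \<le> k}"
  have fin: "finite A" "finite B"
    by (rule finite_subset[of _ "{..Suc k} \<times> {..Suc k}"]; auto simp: A_def B_def)+
  have "{..Suc k} \<times> {..k} = A \<union> B" "A \<inter> B = {}" by (auto simp: A_def B_def)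
  then have "(\<Sum>j\<le>Suc k. \<Sum>i\<le>k. t (j, i)) = sum t A + sum t B"
    by (simp only: sum.cartesian_product sum.union_disjoint[OF fin] case_prod_eta)
  moreover have "sum t A = (\<Sum>x\<in>B. - t x)"
  proof (rule sum.reindex_bij_witness[where i = "\<lambda>(j, i). (Suc i, j)" and j = "\<lambda>(j, i). (i, j - 1)"])
    show "- t (case x of (j, i) \<Rightarrow> (i, j - 1)) = t x" if xA: "x \<in> A" for x
    proof -
      obtain j' i where "x = (j', i)" "i < j'"
        using xA by (auto simp: A_def)
      then obtain j where x: "x = (Suc j, i)" "i \<le> j"
        by (cases j') auto
      have "omit i v j = v (Suc j)" "omit (Suc j) v i = v i" using x by (auto simp: omit_def)
      then show ?thesis
        using x omit_omit[of i "Suc j" v] sym by (simp add: t_def)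
    qed
  qed (auto simp: A_def B_def)
  ultimately show ?thesis
    by (simp add: t_def sum_distrib_left sum_negf)
qed

lemma local_d_local_d:
  assumes S: "open S" and x: "x \<in> S"
    and \<beta>: "\<And>v. Ck_on 2 (\<lambda>y. \<beta> y v) S"
  shows "local_d (Suc k) (local_d k \<beta>) x v = 0"
proof -
  define D where "D w u y = frechet_derivative (\<lambda>y. \<beta> y w) (at y) u" for w u y
  define P where "P w u u' = frechet_derivative (D w u) (at x) u'" for w u u'
  have "P w u u' = P w u' u" for w u u'
    using symmetric_second_derivative[OF S \<beta> x] by (simp add: P_def D_def[abs_def])
  note sym = this
  have D: "(D w u has_derivative P w u) (at x)" for w u
  proof -
    have "Ck_on (Suc 0) (D w u) S"
      using \<beta>[of w] by (simp add: D_def[abs_def] numeral_2_eq_2)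
    from Ck_on_Suc_differentiable[OF S this x] show ?thesis
      by (simp add: P_def[abs_def] frechet_derivative_works)
  qed
  have "frechet_derivative (\<lambda>y. local_d k \<beta> y w) (at x) u =
      (\<Sum>i\<le>k. (-1) ^ i * P (omit i w) (w i) u)" for w u
  proof -
    have "((\<lambda>y. local_d k \<beta> y w) has_derivative
        (\<lambda>u. \<Sum>i\<le>k. (-1) ^ i * P (omit i w) (w i) u)) (at x)"
      unfolding local_d_def D_def[symmetric]
      by (intro has_derivative_sum has_derivative_mult_right D)
    from fun_cong[OF frechet_derivative_at[OF this]] show ?thesis by simp
  qed
  then show ?thesis
    unfolding local_d_def[of "Suc k"] using sum_omit_pairs_eq_0[of P, OF sym] by simp
qed

lemma local_d_scale:
  assumes f: "f differentiable (at x)" and \<eta>: "\<And>v. (\<lambda>y. \<eta> y v) differentiable (at x)"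
  shows "local_d k (\<lambda>y v. f y * \<eta> y v) x v =
         covector_wedge k (frechet_derivative f (at x)) (\<eta> x) v + f x * local_d k \<eta> x v"
proof -
  have "frechet_derivative (\<lambda>y. f y * \<eta> y w) (at x) u =
      f x * frechet_derivative (\<lambda>y. \<eta> y w) (at x) u + frechet_derivative f (at x) u * \<eta> x w" for w u
    using fun_cong[OF frechet_derivative_at[OF has_derivative_mult[OF
        f[unfolded frechet_derivative_works] \<eta>[unfolded frechet_derivative_works, of w]]], of u]
    by simp
  then show ?thesis
    by (simp add: local_d_def covector_wedge_def sum_distrib_left sum.distrib algebra_simps)
qed

text \<open>Near \<open>x\<close> the form \<open>f \<eta>\<close> is the exact form \<open>d\<beta>\<close>, so its derivative vanishes; by the
  product rule that derivative is \<open>df \<and> \<eta> + f d\<eta>\<close>.\<close>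

lemma covector_wedge_deriv_eq_0:
  assumes S: "open S" and x: "x \<in> S"
    and \<beta>: "\<And>v. Ck_on 2 (\<lambda>y. \<beta> y v) S"
    and f: "f differentiable (at x)" and \<eta>: "\<And>v. (\<lambda>y. \<eta> y v) differentiable (at x)"
    and d\<beta>: "\<And>y v. y \<in> S \<Longrightarrow> local_d k \<beta> y v = f y * \<eta> y v"
    and d\<eta>: "\<And>v. local_d (Suc k) \<eta> x v = 0"
  shows "covector_wedge (Suc k) (frechet_derivative f (at x)) (\<eta> x) v = 0"
proof -
  have "frechet_derivative (\<lambda>y. f y * \<eta> y w) (at x) = frechet_derivative (\<lambda>y. local_d k \<beta> y w) (at x)"
    for w
    by (rule frechet_derivative_transform_within_open[OF _ S x]) (simp_all add: d\<beta> f \<eta>)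
  then have "local_d (Suc k) (\<lambda>y v. f y * \<eta> y v) x v = local_d (Suc k) (local_d k \<beta>) x v"
    by (simp add: local_d_def[of "Suc k"])
  then show ?thesis
    using local_d_local_d[OF S x \<beta>] by (simp add: local_d_scale[OF f \<eta>] d\<eta>)
qed

section \<open>Constancy of the coefficient on a connected manifold\<close>

lemma locally_constant_on_connected_space:
  assumes X: "connected_space X"
    and loc: "\<And>p. p \<in> topspace X \<Longrightarrow> \<exists>U. openin X U \<and> p \<in> U \<and> (\<forall>q\<in>U. f q = f p)"
    and p: "p \<in> topspace X" and q: "q \<in> topspace X"
  shows "f p = f q"
proof -
  have open_fibre: "openin X {r \<in> topspace X. f r \<in> C}" for C
  proof (subst openin_subopen, clarify)
    fix r assume r: "r \<in> topspace X" "f r \<in> C"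
    then obtain U where U: "openin X U" "r \<in> U" "\<forall>s\<in>U. f s = f r" using loc by metis
    have "s \<in> topspace X \<and> f s \<in> C" if "s \<in> U" for s
      using U(3)[rule_format, OF that] r(2) openin_subset[OF U(1)] that by auto
    then show "\<exists>T. openin X T \<and> r \<in> T \<and> T \<subseteq> {r \<in> topspace X. f r \<in> C}"
      using U(1,2) by blast
  qed
  have "topspace X - {r \<in> topspace X. f r \<in> {f p}} = {r \<in> topspace X. f r \<in> - {f p}}" by auto
  then have "closedin X {r \<in> topspace X. f r \<in> {f p}}"
    using open_fibre[of "- {f p}"] by (auto simp: closedin_def)
  with X open_fibre[of "{f p}"]
  have "{r \<in> topspace X. f r \<in> {f p}} = {} \<or> {r \<in> topspace X. f r \<in> {f p}} = topspace X"
    unfolding connected_space_clopen_in by blast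
  then have "q \<in> {r \<in> topspace X. f r \<in> {f p}}" using p q by blast
  then show ?thesis by simp
qed

lemma is_chart_chart_inv:
  assumes "is_chart X c" "y \<in> chart_image c"
  shows "chart_inv c y \<in> fst c" "snd c (chart_inv c y) = y"
  using assms by (auto intro: inv_into_into f_inv_into_f)

lemma is_chart_chart_inv_chart:
  assumes "is_chart X c" "p \<in> fst c"
  shows "chart_inv c (snd c p) = p"
proof -
  have "inj_on (snd c) (fst c)"
    using assms(1) openin_subset[of X "fst c"]
    by (auto simp: is_chart_def homeomorphic_eq_everything_map topspace_subtopology_subset Int_absorb1)
  then show ?thesis using assms(2) by (rule inv_into_f_f)
qed

lemma locally_constant_in_chart:
  assumes c: "is_chart X c" and p: "p \<in> fst c"
    and zero: "\<And>y. y \<in> chart_image c \<Longrightarrow> ((\<lambda>x. f (chart_inv c x) :: real) has_derivative (\<lambda>_. 0)) (at y)"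
  shows "\<exists>U. openin X U \<and> p \<in> U \<and> (\<forall>q\<in>U. f q = f p)"
proof -
  have "open (chart_image c)" "snd c p \<in> chart_image c" using c p by (auto simp: is_chart_def)
  then obtain e where e: "e > 0" "ball (snd c p) e \<subseteq> chart_image c"
    using openE by blast
  define U where "U = {q \<in> topspace (subtopology X (fst c)). snd c q \<in> ball (snd c p) e}"
  have U: "U = {q \<in> fst c. snd c q \<in> ball (snd c p) e}"
    using c openin_subset[of X "fst c"] by (auto simp: U_def is_chart_def)
  have "continuous_map (subtopology X (fst c)) (top_of_set (chart_image c)) (snd c)"
    using c by (auto simp: is_chart_def homeomorphic_imp_continuous_map)
  moreover have "openin (top_of_set (chart_image c)) (ball (snd c p) e)"
    using e(2) by (simp add: openin_open_eq[OF \<open>open (chart_image c)\<close>])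
  ultimately have "openin (subtopology X (fst c)) U"
    unfolding U_def by (rule openin_continuous_map_preimage)
  then have "openin X U" using c by (auto simp: is_chart_def intro: openin_trans_full)
  moreover have "f q = f p" if "q \<in> U" for q
  proof -
    have "f (chart_inv c (snd c q)) = f (chart_inv c (snd c p))"
      by (rule has_derivative_zero_unique_connected[of "ball (snd c p) e"])
        (use e that in \<open>auto simp: U intro!: zero\<close>)
    then show ?thesis using is_chart_chart_inv_chart[OF c] p that by (simp add: U)
  qed
  moreover have "p \<in> U" using p e by (simp add: U)
  ultimately show ?thesis by blast
qed

text \<open>In each chart \<open>df \<and> \<eta> = 0\<close>, so injectivity of the product with \<open>\<eta>\<close> gives \<open>df = 0\<close> and \<open>f\<close>
  is locally constant.\<close>

lemma coefficient_constant:
  fixes \<alpha> \<eta> :: "('a, 'e::euclidean_space) diff_form"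
  assumes M: "smooth_manifold X A" and conn: "connected_space X"
    and f: "smooth_function A f"
    and \<alpha>: "\<And>c v. c \<in> A \<Longrightarrow> smooth_on (chart_image c) (\<lambda>x. \<alpha> c (chart_inv c x) v)"
    and \<eta>: "\<And>c v. c \<in> A \<Longrightarrow> smooth_on (chart_image c) (\<lambda>x. \<eta> c (chart_inv c x) v)"
    and d\<alpha>: "diff_form_eq A (ext_deriv k \<alpha>) (\<lambda>c p v. f p * \<eta> c p v)"
    and d\<eta>: "diff_form_eq A (ext_deriv (Suc k) \<eta>) (\<lambda>_ _ _. 0)"
    and inj: "\<And>c p a u. c \<in> A \<Longrightarrow> p \<in> fst c \<Longrightarrow> linear a \<Longrightarrow>
        (\<And>v. covector_wedge (Suc k) a (\<eta> c p) v = 0) \<Longrightarrow> a u = 0"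
    and p: "p \<in> topspace X" and q: "q \<in> topspace X"
  shows "f p = f q"
proof (rule locally_constant_on_connected_space[where f = f, OF conn _ p q])
  fix p assume "p \<in> topspace X"
  then obtain c where c: "c \<in> A" "p \<in> fst c"
    using M unfolding smooth_manifold_def by blast
  have chart: "is_chart X c"
    using M c(1) unfolding smooth_manifold_def by blast
  note inv = is_chart_chart_inv[OF chart]
  have S: "open (chart_image c)" using chart by (simp add: is_chart_def)
  show "\<exists>U. openin X U \<and> p \<in> U \<and> (\<forall>q\<in>U. f q = f p)"
  proof (rule locally_constant_in_chart[OF chart c(2)])
    fix y assume y: "y \<in> chart_image c"
    let ?F = "\<lambda>x. f (chart_inv c x)"
    have F: "?F differentiable (at y)"
      using f c y by (intro Ck_on_Suc_differentiable[OF S, of 0] smooth_on_imp_Ck_on)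
        (auto simp: smooth_function_def)
    have "covector_wedge (Suc k) (frechet_derivative ?F (at y)) (\<eta> c (chart_inv c y)) v = 0" for v
    proof (rule covector_wedge_deriv_eq_0[where \<eta> = "\<lambda>x. \<eta> c (chart_inv c x)"
          and \<beta> = "\<lambda>x. \<alpha> c (chart_inv c x)" and k = k, OF S y _ F])
      show "Ck_on 2 (\<lambda>y. \<alpha> c (chart_inv c y) v) (chart_image c)" for v
        by (intro smooth_on_imp_Ck_on \<alpha> c)
      show "(\<lambda>y. \<eta> c (chart_inv c y) v) differentiable (at y)" for v
        by (intro Ck_on_Suc_differentiable[OF S _ y, of 0] smooth_on_imp_Ck_on \<eta> c)
      show "local_d k (\<lambda>x. \<alpha> c (chart_inv c x)) z v = f (chart_inv c z) * \<eta> c (chart_inv c z) v"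
        if "z \<in> chart_image c" for z v
        using d\<alpha> c inv[OF that] ext_deriv_eq_local_d[of k \<alpha> c "chart_inv c z" v]
        by (simp add: diff_form_eq_def)
      show "local_d (Suc k) (\<lambda>x. \<eta> c (chart_inv c x)) y v = 0" for v
        using d\<eta> c inv[OF y] ext_deriv_eq_local_d[of "Suc k" \<eta> c "chart_inv c y" v]
        by (simp add: diff_form_eq_def)
    qed
    then have D0: "frechet_derivative ?F (at y) = (\<lambda>_. 0)"
      using inj[OF c(1) inv(1)[OF y] linear_frechet_derivative[OF F]] by auto
    show "(?F has_derivative (\<lambda>_. 0)) (at y)"
      using F unfolding frechet_derivative_works D0 .
  qed
qed


section \<open>Alternating forms\<close>

lemma alternating_form_cong:
  "alternating_form k \<alpha> \<Longrightarrow> (\<And>i. i < k \<Longrightarrow> v i = w i) \<Longrightarrow> \<alpha> v = \<alpha> w"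
  by (simp add: alternating_form_def)

lemma alternating_form_linear:
  "alternating_form k \<alpha> \<Longrightarrow> i < k \<Longrightarrow> linear (\<lambda>x. \<alpha> (v(i := x)))"
  by (simp add: alternating_form_def)

lemma alternating_form_eq_0:
  "alternating_form k \<alpha> \<Longrightarrow> i < k \<Longrightarrow> j < k \<Longrightarrow> i \<noteq> j \<Longrightarrow> v i = v j \<Longrightarrow> \<alpha> v = 0"
  unfolding alternating_form_def by blast

lemma linear_functional_expand:
  fixes f :: "real^'n \<Rightarrow> real"
  assumes "linear f"
  shows "f z = (\<Sum>a\<in>UNIV. z $ a * f (axis a 1))"
proof -
  have "f z = f (\<Sum>a\<in>UNIV. z $ a *\<^sub>R axis a 1)"
    by (simp add: basis_expansion[of z, unfolded scalar_mult_eq_scaleR])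
  then show ?thesis by (simp add: linear_sum[OF assms] linear_cmul[OF assms])
qed

lemma alternating_form_expand_argument:
  fixes \<alpha> :: "(real^'n) form"
  assumes "alternating_form k \<alpha>" "i < k"
  shows "\<alpha> v = (\<Sum>a\<in>UNIV. v i $ a * \<alpha> (v(i := axis a 1)))"
  using linear_functional_expand[OF alternating_form_linear[OF assms, of v], of "v i"] by simp

text \<open>The vector fields \<open>w\<close> replace constant arguments \<open>v\<close> one at a time, each being expanded
  in the standard basis.\<close>

lemma Ck_on_form_apply:
  fixes \<alpha> :: "'e::real_normed_vector \<Rightarrow> (real^'n) form"
  assumes S: "open S"
    and alt: "\<And>x. x \<in> S \<Longrightarrow> alternating_form k (\<alpha> x)"
    and \<alpha>: "\<And>v. Ck_on n (\<lambda>x. \<alpha> x v) S"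
    and w: "\<And>i a. i < k \<Longrightarrow> Ck_on n (\<lambda>x. w x i $ a) S"
  shows "Ck_on n (\<lambda>x. \<alpha> x (w x)) S"
proof -
  \<comment> \<open>Arguments from \<open>m\<close> on are constant, so a basis vector may be put in place \<open>m\<close>.\<close>
  have "Ck_on n (\<lambda>x. \<alpha> x (\<lambda>i. if i < m then w x i else v i)) S" if "m \<le> k" for m v
    using that
  proof (induction m arbitrary: v)
    case 0
    show ?case using \<alpha> by simp
  next
    case (Suc m)
    let ?u = "\<lambda>x i. if i < Suc m then w x i else v i"
    let ?b = "\<lambda>a x i. if i < m then w x i else (v(m := axis a 1)) i"
    have "(?u x)(m := axis a 1) = ?b a x" for x a by (auto simp: fun_eq_iff)
    then have "\<alpha> x (?u x) = (\<Sum>a\<in>UNIV. w x m $ a * \<alpha> x (?b a x))" if "x \<in> S" for x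
      using alternating_form_expand_argument[OF alt[OF that], of m "?u x"] Suc.prems by simp
    moreover have "Ck_on n (\<lambda>x. \<Sum>a\<in>UNIV. w x m $ a * \<alpha> x (?b a x)) S"
      using Suc by (intro Ck_on_sum[OF S] Ck_on_mult[OF S] w Suc.IH) auto
    ultimately show ?case by (subst Ck_on_cong[OF S]) auto
  qed
  from this[of k] have "Ck_on n (\<lambda>x. \<alpha> x (\<lambda>i. if i < k then w x i else undefined)) S" by simp
  moreover have "\<alpha> x (\<lambda>i. if i < k then w x i else undefined) = \<alpha> x (w x)" if "x \<in> S" for x
    by (rule alternating_form_cong[OF alt[OF that]]) simp
  ultimately show ?thesis by (subst Ck_on_cong[OF S]) auto
qed

text \<open>Finitely many arguments, with the last one repeated forever, as in the definition of \<open>h\<close>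
  from \<open>\<omega>\<close> and \<open>J\<close>.\<close>

definition args2 :: "'v \<Rightarrow> 'v \<Rightarrow> nat \<Rightarrow> 'v" where
  "args2 x y = case_nat x (\<lambda>_. y)"

definition args3 :: "'v \<Rightarrow> 'v \<Rightarrow> 'v \<Rightarrow> nat \<Rightarrow> 'v" where
  "args3 x y z = case_nat x (args2 y z)"

lemma alternating_2form_eq: "alternating_form 2 \<omega> \<Longrightarrow> \<omega> v = \<omega> (args2 (v 0) (v 1))"
  by (erule alternating_form_cong) (auto simp: args2_def less_2_cases_iff)

lemma alternating_3form_eq: "alternating_form 3 \<rho> \<Longrightarrow> \<rho> v = \<rho> (args3 (v 0) (v 1) (v 2))"
  by (erule alternating_form_cong)
    (auto simp: args2_def args3_def numeral_3_eq_3 numeral_2_eq_2 less_Suc_eq)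

lemma alternating_2form_bilinear:
  assumes "alternating_form 2 \<omega>"
  shows "bilinear (\<lambda>x y. \<omega> (args2 x y))"
proof -
  have 1: "(\<lambda>y. \<omega> (args2 x y)) = (\<lambda>y. \<omega> ((args2 x x)(1 := y)))" for x
    by (rule ext, rule alternating_form_cong[OF assms]) (auto simp: args2_def less_2_cases_iff)
  have 2: "(\<lambda>x. \<omega> (args2 x y)) = (\<lambda>x. \<omega> ((args2 y y)(0 := x)))" for y
    by (rule ext, rule alternating_form_cong[OF assms]) (auto simp: args2_def less_2_cases_iff)
  have "linear (\<lambda>y. \<omega> (args2 x y))" "linear (\<lambda>x. \<omega> (args2 x y))" for x y
    unfolding 1[of x] 2[of y] by (rule alternating_form_linear[OF assms], simp)+
  then show ?thesis by (simp add: bilinear_def)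
qed

lemma alternating_2form_self: "alternating_form 2 \<omega> \<Longrightarrow> \<omega> (args2 x x) = 0"
  by (rule alternating_form_eq_0[of 2 \<omega> 0 1]) (auto simp: args2_def)

lemma alternating_2form_swap:
  assumes "alternating_form 2 \<omega>"
  shows "\<omega> (args2 y x) = - \<omega> (args2 x y)"
proof -
  have "\<omega> (args2 (x + y) (x + y)) = 0" "\<omega> (args2 x x) = 0" "\<omega> (args2 y y) = 0"
    using alternating_2form_self[OF assms] by auto
  then show ?thesis
    by (simp add: bilinear_ladd[OF alternating_2form_bilinear[OF assms]]
        bilinear_radd[OF alternating_2form_bilinear[OF assms]])
qed

text \<open>The summands at \<open>\<sigma>\<close> and at \<open>\<sigma>\<close> composed with the transposition cancel.\<close>

lemma sum_sign_symmetric_eq_0: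
  fixes F :: "(nat \<Rightarrow> nat) \<Rightarrow> real"
  assumes S: "finite S" and ij: "i \<in> S" "j \<in> S" "i \<noteq> j"
    and F: "\<And>\<sigma>. F (\<sigma> \<circ> Transposition.transpose i j) = F \<sigma>"
  shows "(\<Sum>\<sigma> | \<sigma> permutes S. of_int (sign \<sigma>) * F \<sigma>) = 0"
proof -
  let ?t = "Transposition.transpose i j"
  have t: "?t permutes S" using ij by (intro permutes_swap_id)
  have "(\<Sum>\<sigma> | \<sigma> permutes S. of_int (sign \<sigma>) * F \<sigma>) =
      (\<Sum>\<sigma> | \<sigma> permutes S. of_int (sign (\<sigma> \<circ> ?t)) * F (\<sigma> \<circ> ?t))"
    by (rule sum_permutations_compose_right[OF t])
  also have "\<dots> = (\<Sum>\<sigma> | \<sigma> permutes S. - (of_int (sign \<sigma>) * F \<sigma>))"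
    using S t ij(3) by (intro sum.cong refl)
      (simp add: F sign_compose permutes_imp_permutation[OF S] permutation_swap_id sign_swap_id)
  finally show ?thesis by (simp add: sum_negf)
qed

text \<open>Here \<open>\<alpha> = p \<and> a\<close> and \<open>\<beta> = a \<and> q\<close> have the common factor \<open>a\<close>. Each of the six products
  arising from the expansion contains \<open>a\<close> at two different arguments, so it is killed by
  antisymmetrization.\<close>

lemma wedge_2_3_with_common_covector:
  fixes a p :: "'v \<Rightarrow> real" and q :: "'v \<Rightarrow> 'v \<Rightarrow> real"
  assumes \<alpha>: "\<And>v. \<alpha> v = a (v 1) * p (v 0) - a (v 0) * p (v 1)"
    and \<beta>: "\<And>v. \<beta> v = a (v 0) * q (v 1) (v 2) - a (v 1) * q (v 0) (v 2) + a (v 2) * q (v 0) (v 1)"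
  shows "wedge 2 3 \<alpha> \<beta> = (\<lambda>_. 0)"
proof
  fix v :: "nat \<Rightarrow> 'v"
  define T where "T i j k l m \<sigma> =
      a (v (\<sigma> i)) * a (v (\<sigma> j)) * (p (v (\<sigma> k)) * q (v (\<sigma> l)) (v (\<sigma> m)))"
    for i j k l m and \<sigma> :: "nat \<Rightarrow> nat"
  have T: "(\<Sum>\<sigma> | \<sigma> permutes {..<5}. of_int (sign \<sigma>) * T i j k l m \<sigma>) = 0"
    if "distinct [i, j, k, l, m]" "i < 5" "j < 5" for i j k l m
    using that
    by (intro sum_sign_symmetric_eq_0[of _ i j]) (auto simp: T_def Transposition.transpose_def)
  have "of_int (sign \<sigma>) * \<alpha> (\<lambda>i. v (\<sigma> i)) * \<beta> (\<lambda>i. v (\<sigma> (2 + i))) =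
      of_int (sign \<sigma>) * T 1 2 0 3 4 \<sigma> - of_int (sign \<sigma>) * T 1 3 0 2 4 \<sigma>
      + of_int (sign \<sigma>) * T 1 4 0 2 3 \<sigma> - of_int (sign \<sigma>) * T 0 2 1 3 4 \<sigma>
      + of_int (sign \<sigma>) * T 0 3 1 2 4 \<sigma> - of_int (sign \<sigma>) * T 0 4 1 2 3 \<sigma>" for \<sigma>
    by (simp add: \<alpha> \<beta> T_def numeral_eq_Suc algebra_simps)
  then show "wedge 2 3 \<alpha> \<beta> v = 0"
    by (simp add: wedge_def sum.distrib sum_subtractf T)
qed

text \<open>Each of the three ways to split four arguments into pairs comes from eight permutations,
  and the normalization of \<open>wedge\<close> divides by \<open>2! 2! = 4\<close>.\<close>

lemma wedge_2_2_same:
  assumes \<omega>: "alternating_form 2 \<omega>"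
  defines "W \<equiv> \<lambda>v i j. \<omega> (args2 (v i) (v j))"
  shows "wedge 2 2 \<omega> \<omega> v = 2 * (W v 0 1 * W v 2 3 - W v 0 2 * W v 1 3 + W v 0 3 * W v 1 2)"
proof -
  have set: "{..<4} = insert 0 (insert 1 (insert 2 (insert (3::nat) {})))" by auto
  have "W v j i = - W v i j" for i j
    unfolding W_def by (rule alternating_2form_swap[OF \<omega>])
  then have swap: "W v 1 0 = - W v 0 1" "W v 2 0 = - W v 0 2" "W v 3 0 = - W v 0 3"
    "W v 2 1 = - W v 1 2" "W v 3 1 = - W v 1 3" "W v 3 2 = - W v 2 3" by blast+
  have "(\<Sum>\<sigma> | \<sigma> permutes {..<4}. of_int (sign \<sigma>) * W v (\<sigma> 0) (\<sigma> 1) * W v (\<sigma> 2) (\<sigma> 3)) =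
      8 * (W v 0 1 * W v 2 3 - W v 0 2 * W v 1 3 + W v 0 3 * W v 1 2)"
    unfolding set
    by (simp add: sum_over_permutations_insert sign_compose permutation_compose permutation_swap_id
        sign_swap_id Transposition.transpose_def swap[unfolded One_nat_def]
        algebra_simps)
  moreover have "\<omega> (\<lambda>i. v (\<sigma> i)) = W v (\<sigma> 0) (\<sigma> 1)"
    "\<omega> (\<lambda>i. v (\<sigma> (2 + i))) = W v (\<sigma> 2) (\<sigma> 3)" for \<sigma>
    unfolding W_def
    using alternating_2form_eq[OF \<omega>, of "\<lambda>i. v (\<sigma> i)"] alternating_2form_eq[OF \<omega>, of "\<lambda>i. v (\<sigma> (2 + i))"]
    by (simp_all add: numeral_3_eq_3)
  ultimately show ?thesis by (simp add: wedge_def)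
qed


section \<open>Injectivity of the wedge product with a covector\<close>

lemma exists_common_zero:
  fixes F :: "('v::euclidean_space \<Rightarrow> real) set"
  assumes "finite F" "card F < DIM('v)" and lin: "\<And>f. f \<in> F \<Longrightarrow> linear f"
  shows "\<exists>x. x \<noteq> 0 \<and> (\<forall>f\<in>F. f x = 0)"
proof -
  let ?R = "(\<lambda>f. adjoint f 1) ` F"
  have "dim ?R \<le> card ?R" using assms(1) by (intro dim_le_card') auto
  also have "\<dots> < DIM('v)" using card_image_le[OF assms(1), of "\<lambda>f. adjoint f 1"] assms(2) by linarith
  finally have "dim ?R < DIM('v)" .
  then obtain x where x: "x \<noteq> 0" "span ?R \<subseteq> {y. x \<bullet> y = 0}"
    using lowdim_subset_hyperplane[of ?R] by blast
  have "f x = 0" if "f \<in> F" for f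
  proof -
    have "x \<bullet> adjoint f 1 = 0" using x(2) that span_base[of "adjoint f 1" ?R] by auto
    then show ?thesis using adjoint_works[OF lin[OF that], of x 1] by simp
  qed
  then show ?thesis using x(1) by blast
qed

lemma covector_wedge_kernel:
  assumes "\<And>i. i < k \<Longrightarrow> a (v i) = 0"
  shows "covector_wedge k a \<eta> (case_nat u v) = a u * \<eta> v"
proof -
  have "omit 0 (case_nat u v) = v" by (simp add: omit_def)
  moreover have "(\<Sum>i<k. (-1) ^ Suc i * a (case_nat u v (Suc i)) * \<eta> (omit (Suc i) (case_nat u v))) = 0"
    using assms by (intro sum.neutral) auto
  ultimately show ?thesis by (simp add: covector_wedge_def sum.atMost_shift)
qed

text \<open>Contracting \<open>a \<and> \<psi> = 0\<close> with a vector \<open>u\<close> such that \<open>a(u) = 1\<close> gives \<open>\<psi> = a \<and> i\<^sub>u\<psi>\<close>.\<close>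

lemma covector_wedge_3_eq_0D:
  assumes \<psi>: "alternating_form 3 \<psi>" and "covector_wedge 3 a \<psi> (case_nat u v) = 0" "a u = 1"
  shows "\<psi> v = a (v 0) * \<psi> (args3 u (v 1) (v 2)) - a (v 1) * \<psi> (args3 u (v 0) (v 2))
           + a (v 2) * \<psi> (args3 u (v 0) (v 1))"
proof -
  let ?w = "case_nat u v"
  have "omit 0 ?w = v" by (simp add: omit_def)
  moreover have "\<psi> (omit 1 ?w) = \<psi> (args3 u (v 1) (v 2))" "\<psi> (omit 2 ?w) = \<psi> (args3 u (v 0) (v 2))"
    "\<psi> (omit 3 ?w) = \<psi> (args3 u (v 0) (v 1))"
    using alternating_3form_eq[OF \<psi>, of "omit 1 ?w"] alternating_3form_eq[OF \<psi>, of "omit 2 ?w"]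
      alternating_3form_eq[OF \<psi>, of "omit 3 ?w"]
    by (simp_all add: omit_def numeral_eq_Suc)
  ultimately show ?thesis
    using assms(2,3) by (simp add: covector_wedge_def numeral_eq_Suc)
qed

text \<open>The part of an \<open>SU(3)\<close>-structure at a point on which both injectivity statements rest.
  \<open>J\<close> is a bare function because \<open>J_map\<close> is given by a description, whose linearity is not
  evident.\<close>

locale tamed =
  fixes \<omega> :: "'v::euclidean_space form" and J :: "'v \<Rightarrow> 'v"
  assumes alternating: "alternating_form 2 \<omega>"
    and metric: "bilinear (\<lambda>u v. \<omega> (args2 u (J v)))"
    and positive: "u \<noteq> 0 \<Longrightarrow> \<omega> (args2 u (J u)) > 0"
begin

abbreviation W where "W u v \<equiv> \<omega> (args2 u v)"

lemmas bilinear_W = alternating_2form_bilinear[OF alternating]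
lemmas W_simps = bilinear_ladd[OF bilinear_W] bilinear_radd[OF bilinear_W]
  bilinear_lsub[OF bilinear_W] bilinear_rsub[OF bilinear_W]
  bilinear_lmul[OF bilinear_W] bilinear_rmul[OF bilinear_W]
  bilinear_lzero[OF bilinear_W] bilinear_rzero[OF bilinear_W] alternating_2form_self[OF alternating]
lemmas W_swap = alternating_2form_swap[OF alternating]

lemma linear_W: "linear (W u)"
  using bilinear_W by (simp add: bilinear_def)

lemma nondegenerate:
  assumes "\<And>u. W u z = 0"
  shows "z = 0"
proof (rule ccontr)
  assume "z \<noteq> 0"
  then have "W z (J z) > 0" by (rule positive)
  then show False using W_swap[of z "J z"] assms[of "J z"] by simp
qed

text \<open>Nondegeneracy of \<open>\<omega>\<close> transfers linearity of \<open>\<omega>(u, J v)\<close> in \<open>v\<close> to \<open>J\<close>.\<close>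

lemma linear_J: "linear J"
proof (rule linearI)
  show "J (x + y) = J x + J y" for x y
    using nondegenerate[of "J (x + y) - (J x + J y)"] bilinear_radd[OF metric]
    by (simp add: W_simps)
  show "J (r *\<^sub>R x) = r *\<^sub>R J x" for r x
    using nondegenerate[of "J (r *\<^sub>R x) - r *\<^sub>R J x"] bilinear_rmul[OF metric]
    by (simp add: W_simps)
qed

text \<open>If \<open>a(e) = 1\<close>, then subtracting a multiple of \<open>e\<close> moves \<open>J u\<close> into the kernel of the
  covector \<open>a\<close>; its pairing with \<open>u\<close> stays positive.\<close>

lemma positive_modulo: "u \<noteq> 0 \<Longrightarrow> W u e = 0 \<Longrightarrow> W u (J u - t *\<^sub>R e) > 0"
  using positive[of u] by (simp add: W_simps)

end

text \<open>With \<open>\<psi> = a \<and> \<beta>\<close> and \<open>a(u) = 0\<close> one has \<open>i\<^sub>u\<psi> = - a \<and> i\<^sub>u\<beta>\<close>, so both factors are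
  divisible by \<open>a\<close>.\<close>

lemma interior_prod_wedge_eq_0:
  assumes \<psi>: "alternating_form 3 \<psi>" and e: "a e = 1"
    and div: "\<And>v. covector_wedge 3 a \<psi> v = 0" and u: "a u = 0"
  shows "wedge 2 3 (interior_prod u \<psi>) \<psi> = (\<lambda>_. 0)"
proof (rule wedge_2_3_with_common_covector[where a = a and p = "\<lambda>x. \<psi> (args3 e u x)"
      and q = "\<lambda>x y. \<psi> (args3 e x y)"])
  show "interior_prod u \<psi> v = a (v 1) * \<psi> (args3 e u (v 0)) - a (v 0) * \<psi> (args3 e u (v 1))" for v
    unfolding interior_prod_def
    by (subst covector_wedge_3_eq_0D[OF \<psi> div e]) (simp add: u numeral_2_eq_2)
  show "\<psi> v = a (v 0) * \<psi> (args3 e (v 1) (v 2)) - a (v 1) * \<psi> (args3 e (v 0) (v 2))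
      + a (v 2) * \<psi> (args3 e (v 0) (v 1))" for v
    by (rule covector_wedge_3_eq_0D[OF \<psi> div e])
qed

text \<open>If \<open>\<psi>\<close> is divisible by \<open>a\<close>, then \<open>K\<^sub>\<psi>\<close> is the same on all multiples of a vector
  \<open>x \<in> ker a\<close>. As \<open>J u\<close> depends on \<open>u\<close> only through \<open>K\<^sub>\<psi>(u)\<close>, linearity of \<open>J\<close> forces
  \<open>J x = 0\<close>, contrary to \<open>\<omega>(x, J x) > 0\<close>. Comparing \<open>x\<close> with \<open>2 x\<close> avoids evaluating the
  descriptions behind \<open>K\<close> and \<open>J\<close>.\<close>

lemma covector_wedge_psi_injective:
  assumes \<psi>: "alternating_form 3 \<psi>" and tamed: "tamed \<omega> (J_map \<omega> \<psi>)"
    and a: "linear a" and div: "\<And>v. covector_wedge 3 a \<psi> v = 0"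
  shows "a u = 0"
proof (rule ccontr)
  assume u: "a u \<noteq> 0"
  interpret tamed \<omega> "J_map \<omega> \<psi>" by (rule tamed)
  define e where "e = (1 / a u) *\<^sub>R u"
  have e: "a e = 1" using u by (simp add: e_def linear_cmul[OF a])
  then have "e \<noteq> 0" using linear_0[OF a] by auto
  \<comment> \<open>The component of \<open>J e\<close> in the kernel of \<open>a\<close>; it is nonzero since \<open>\<omega>(e, J e) > 0\<close>.\<close>
  define x where "x = J_map \<omega> \<psi> e - a (J_map \<omega> \<psi> e) *\<^sub>R e"
  have ax: "a (t *\<^sub>R x) = 0" for t
    by (simp add: x_def e linear_cmul[OF a] linear_diff[OF a])
  have "W e x > 0" unfolding x_def by (rule positive_modulo[OF \<open>e \<noteq> 0\<close>]) (simp add: W_simps)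
  then have "x \<noteq> 0" by (auto simp: W_simps)
  have "K_map \<psi> (t *\<^sub>R x) = i_iso (\<lambda>_. 0)" for t
    unfolding K_map_def interior_prod_wedge_eq_0[OF \<psi> e div ax] ..
  then have "J_map \<omega> \<psi> (2 *\<^sub>R x) = J_map \<omega> \<psi> (1 *\<^sub>R x)"
    unfolding J_map_def by metis
  then have "2 *\<^sub>R J_map \<omega> \<psi> x = 1 *\<^sub>R J_map \<omega> \<psi> x"
    unfolding linear_cmul[OF linear_J] .
  then have "J_map \<omega> \<psi> x = 0" unfolding scaleR_cancel_right by simp
  then show False using positive[OF \<open>x \<noteq> 0\<close>] by (simp add: W_simps)
qed

text \<open>In the kernel of \<open>a\<close> there are \<open>x, y\<close> with \<open>\<omega>(x, y) \<noteq> 0\<close> and \<open>z, v\<close> with \<open>\<omega>(z, v) \<noteq> 0\<close>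
  that are \<open>\<omega>\<close>-orthogonal to \<open>x\<close> and \<open>y\<close>, whence \<open>\<omega>\<^sup>2(x, y, z, v) = 2 \<omega>(x, y) \<omega>(z, v) \<noteq> 0\<close>. The
  vectors \<open>x\<close> and \<open>z\<close> are common zeros of at most four functionals, fewer than the dimension,
  and their partners come from \<open>J x\<close> and \<open>J z\<close> by projection to \<open>ker a\<close>. These projections are
  along \<open>e\<close>, which explains the conditions \<open>\<omega>(e, x) = 0\<close> and \<open>\<omega>(e, z) = 0\<close>.\<close>

lemma (in tamed) covector_wedge_square_injective:
  assumes dim: "DIM('v) = 6"
    and a: "linear a" and div: "\<And>v. covector_wedge 4 a (wedge 2 2 \<omega> \<omega>) v = 0"
  shows "a u = 0"
proof (rule ccontr)
  assume u: "a u \<noteq> 0"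
  define e where "e = (1 / a u) *\<^sub>R u"
  have e: "a e = 1" using u by (simp add: e_def linear_cmul[OF a])
  note a_simps = linear_cmul[OF a] linear_diff[OF a] linear_add[OF a] e
  have card: "card {f, g, h, k} < DIM('v)" for f g h k :: "'v \<Rightarrow> real"
    using card_length[of "[f, g, h, k]"] dim by simp
  \<comment> \<open>Repetitions allow the cardinality bound for four functionals to be reused.\<close>
  have "\<exists>x. x \<noteq> 0 \<and> (\<forall>f\<in>{a, a, W e, W e}. f x = 0)"
    by (intro exists_common_zero card) (use a linear_W in auto)
  then obtain x where x: "x \<noteq> 0" "a x = 0" "W e x = 0" by auto
  define y where "y = J x - a (J x) *\<^sub>R e"
  have "W x e = 0" using x(3) W_swap[of e x] by simp
  then have y: "a y = 0" "W x y > 0"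
    unfolding y_def by (simp add: a_simps, rule positive_modulo[OF x(1)])
  have "\<exists>z. z \<noteq> 0 \<and> (\<forall>f\<in>{a, W e, W x, W y}. f z = 0)"
    by (intro exists_common_zero card) (use a linear_W in auto)
  then obtain z where z: "z \<noteq> 0" "a z = 0" "W e z = 0" "W x z = 0" "W y z = 0" by auto
  define w where "w = J z - a (J z) *\<^sub>R e"
  have "W z e = 0" using z(3) W_swap[of e z] by simp
  then have w: "a w = 0" "W z w > 0"
    unfolding w_def by (simp add: a_simps, rule positive_modulo[OF z(1)])
  \<comment> \<open>Projection of \<open>w\<close> to the \<open>\<omega>\<close>-orthogonal complement of \<open>x\<close> and \<open>y\<close>, which already contains \<open>z\<close>.\<close>
  define v where "v = w - (W w y / W x y) *\<^sub>R x - (W x w / W x y) *\<^sub>R y"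
  have v: "a v = 0" "W x v = 0" "W y v = 0" "W z v = W z w"
    using w(1) y x(2) z(4,5) W_swap[of x y] W_swap[of w y] W_swap[of x z] W_swap[of y z]
    by (simp_all add: v_def a_simps W_simps)
  let ?q = "case_nat x (case_nat y (args2 z v))"
  have "a (?q i) = 0" for i
    using x y z v by (auto simp: args2_def split: nat.split)
  then have "wedge 2 2 \<omega> \<omega> ?q = 0"
    using div[of "case_nat e ?q"] covector_wedge_kernel[of 4 a ?q "wedge 2 2 \<omega> \<omega>" e] e by simp
  moreover have "wedge 2 2 \<omega> \<omega> ?q = 2 * (W x y * W z v - W x z * W y v + W x v * W y z)"
    unfolding wedge_2_2_same[OF alternating] by (simp add: args2_def numeral_eq_Suc)
  ultimately show False using v w y z by simp
qed

section \<open>Smoothness of \<open>\<psi>\<^sub>-\<close> and \<open>\<omega>\<^sup>2\<close>\<close>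

text \<open>The coordinates of \<open>J u\<close> solve the linear system with matrix \<open>\<omega>(e\<^sub>i, e\<^sub>j)\<close> and right-hand
  side \<open>\<omega>(e\<^sub>i, J u) = h(e\<^sub>i, u)\<close>, both of class \<open>C\<^sup>k\<close>; the matrix is invertible as \<open>\<omega>\<close> is
  nondegenerate.\<close>

lemma Ck_on_psi_minus:
  fixes \<omega> \<psi> :: "('a, real^6) diff_form"
  assumes c: "is_chart X c"
    and tamed: "\<And>p. p \<in> fst c \<Longrightarrow> tamed (\<omega> c p) (J_map (\<omega> c p) (\<psi> c p))"
    and alt: "\<And>p. p \<in> fst c \<Longrightarrow> alternating_form 3 (\<psi> c p)"
    and \<omega>: "\<And>v. Ck_on n (\<lambda>x. \<omega> c (chart_inv c x) v) (chart_image c)"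
    and \<psi>: "\<And>v. Ck_on n (\<lambda>x. \<psi> c (chart_inv c x) v) (chart_image c)"
    and h: "\<And>u v. Ck_on n (\<lambda>x. \<omega> c (chart_inv c x)
        (args2 u (J_map (\<omega> c (chart_inv c x)) (\<psi> c (chart_inv c x)) v))) (chart_image c)"
  shows "Ck_on n (\<lambda>x. psi_minus \<omega> \<psi> c (chart_inv c x) v) (chart_image c)"
proof -
  let ?S = "chart_image c"
  let ?\<omega> = "\<lambda>x. \<omega> c (chart_inv c x)" and ?\<psi> = "\<lambda>x. \<psi> c (chart_inv c x)"
  let ?J = "\<lambda>x. J_map (?\<omega> x) (?\<psi> x)"
  have S: "open ?S" using c by (simp add: is_chart_def)
  have T: "tamed (?\<omega> x) (?J x)" if "x \<in> ?S" for x
    by (intro tamed is_chart_chart_inv[OF c that])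
  let ?M = "\<lambda>x. \<chi> i j. ?\<omega> x (args2 (axis i 1) (axis j 1))"
  have M: "(?M x *v z) $ i = ?\<omega> x (args2 (axis i 1) z)" if "x \<in> ?S" for x z i
    using linear_functional_expand[OF tamed.linear_W[OF T[OF that]], of "axis i 1" z]
    by (simp add: matrix_vector_mult_def mult.commute)
  have J: "Ck_on n (\<lambda>x. ?J x u $ a) ?S" for u a
  proof (rule Ck_on_solution_of_linear_system[OF S, of n ?M "\<lambda>x. \<chi> i. ?\<omega> x (args2 (axis i 1) (?J x u))"])
    fix x z assume x: "x \<in> ?S" and z: "?M x *v z = 0"
    interpret tamed "?\<omega> x" "?J x" by (rule T[OF x])
    have "W (axis i 1) z = 0" for i using M[OF x, of z i] z by simp
    then have "W y z = 0" for y
      using linear_functional_expand[OF linear_W, of z y] W_swap[of z] by simp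
    then show "z = 0" by (rule nondegenerate)
  qed (simp_all add: \<omega> h vec_eq_iff M)
  have "Ck_on n (\<lambda>x. ?\<psi> x (\<lambda>i. ?J x (v i))) ?S"
    by (rule Ck_on_form_apply[where k = 3, OF S _ \<psi> J]) (intro alt is_chart_chart_inv[OF c])
  then show ?thesis by (simp add: psi_minus_def pullback_def)
qed

lemma Ck_on_wedge:
  assumes S: "open S" and "\<And>v. Ck_on n (\<lambda>x. \<alpha> x v) S" "\<And>v. Ck_on n (\<lambda>x. \<beta> x v) S"
  shows "Ck_on n (\<lambda>x. wedge k l (\<alpha> x) (\<beta> x) v) S"
  unfolding wedge_def divide_inverse
  by (intro Ck_on_mult[OF S] Ck_on_sum[OF S] Ck_on_const assms)

section \<open>Coupled and double structures\<close>

theorem lemma2p2: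
  fixes X :: "'a topology"
    and A :: "('a, real^6) chart set"
    and \<omega> \<psi> :: "('a, real^6) diff_form"
  assumes "smooth_manifold X A"
    and "connected_space X"
    and "SU3_structure A \<omega> \<psi>"
  shows "(coupled X A \<omega> \<psi> \<longrightarrow>
           (\<exists>c::real. c \<noteq> 0 \<and> diff_form_eq A (ext_deriv 2 \<omega>) (\<lambda>x p v. c * \<psi> x p v))) \<and>
         (double X A \<omega> \<psi> \<longrightarrow>
           (\<exists>k::real. k \<noteq> 0 \<and>
              diff_form_eq A (ext_deriv 3 (psi_minus \<omega> \<psi>)) (\<lambda>x p v. k * omega_squared \<omega> x p v)))"
proof -
  note M = assms(1) and SU3 = assms(3)[unfolded SU3_structure_def riemannian_metric_def is_diff_form_def]
  have chart: "is_chart X c" if "c \<in> A" for c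
    using M that unfolding smooth_manifold_def by blast
  have sub: "fst c \<subseteq> topspace X" if "c \<in> A" for c
    using chart[OF that] openin_subset by (auto simp: is_chart_def)
  have pointwise: "\<forall>c\<in>A. \<forall>p\<in>fst c. alternating_form 2 (\<omega> c p)"
      "\<forall>c\<in>A. \<forall>p\<in>fst c. alternating_form 3 (\<psi> c p)"
      "\<forall>c\<in>A. \<forall>p\<in>fst c. bilinear (\<lambda>u v. \<omega> c p (case_nat u (\<lambda>_. J_map (\<omega> c p) (\<psi> c p) v))) \<and>
         (\<forall>u v. \<omega> c p (case_nat u (\<lambda>_. J_map (\<omega> c p) (\<psi> c p) v)) =
                \<omega> c p (case_nat v (\<lambda>_. J_map (\<omega> c p) (\<psi> c p) u))) \<and>
         (\<forall>u. u \<noteq> 0 \<longrightarrow> \<omega> c p (case_nat u (\<lambda>_. J_map (\<omega> c p) (\<psi> c p) u)) > 0)"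
    and smooth: "\<forall>c\<in>A. \<forall>v. smooth_on (chart_image c) (\<lambda>x. \<omega> c (chart_inv c x) v)"
      "\<forall>c\<in>A. \<forall>v. smooth_on (chart_image c) (\<lambda>x. \<psi> c (chart_inv c x) v)"
      "\<forall>c\<in>A. \<forall>u v. smooth_on (chart_image c) (\<lambda>x. \<omega> c (chart_inv c x)
         (case_nat u (\<lambda>_. J_map (\<omega> c (chart_inv c x)) (\<psi> c (chart_inv c x)) v)))"
    by (rule conjE[OF SU3], elim conjE, assumption)+
  have tamed: "tamed (\<omega> c p) (J_map (\<omega> c p) (\<psi> c p))" if "c \<in> A" "p \<in> fst c" for c p
    using pointwise(1)[rule_format, OF that] pointwise(3)[rule_format, OF that]
    by (simp add: tamed_def args2_def)
  have alt: "alternating_form 3 (\<psi> c p)" if "c \<in> A" "p \<in> fst c" for c p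
    by (rule pointwise(2)[rule_format, OF that])
  have \<omega>: "smooth_on (chart_image c) (\<lambda>x. \<omega> c (chart_inv c x) v)"
    and \<psi>: "smooth_on (chart_image c) (\<lambda>x. \<psi> c (chart_inv c x) v)"
    and h: "smooth_on (chart_image c) (\<lambda>x. \<omega> c (chart_inv c x)
        (args2 u (J_map (\<omega> c (chart_inv c x)) (\<psi> c (chart_inv c x)) w)))" if "c \<in> A" for c v u w
    unfolding args2_def by (rule smooth[rule_format, OF that])+
  have \<psi>_minus: "smooth_on (chart_image c) (\<lambda>x. psi_minus \<omega> \<psi> c (chart_inv c x) v)"
    if "c \<in> A" for c v
    unfolding smooth_on_def using tamed alt \<omega> \<psi> h that
    by (intro allI Ck_on_psi_minus[OF chart[OF that]] smooth_on_imp_Ck_on) auto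
  have \<omega>2: "smooth_on (chart_image c) (\<lambda>x. omega_squared \<omega> c (chart_inv c x) v)"
    if "c \<in> A" for c v
    unfolding smooth_on_def omega_squared_def using \<omega>[OF that] chart[OF that]
    by (intro allI Ck_on_wedge smooth_on_imp_Ck_on) (auto simp: is_chart_def)
  have const: "\<exists>c::real. c \<noteq> 0 \<and> diff_form_eq A \<alpha> (\<lambda>x p v. c * \<eta> x p v)"
    if "\<And>p q. p \<in> topspace X \<Longrightarrow> q \<in> topspace X \<Longrightarrow> f p = f q" "\<forall>p\<in>topspace X. f p \<noteq> 0"
      "diff_form_eq A \<alpha> (\<lambda>c p v. f p * \<eta> c p v)" for f :: "'a \<Rightarrow> real" and \<alpha> \<eta>
  proof -
    obtain c where c: "c \<noteq> 0" "\<And>p. p \<in> topspace X \<Longrightarrow> f p = c"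
    proof (cases "topspace X = {}")
      case True
      \<comment> \<open>On an empty manifold any nonzero constant serves.\<close>
      show ?thesis by (rule that[of 1]) (auto simp: True)
    next
      case False
      then obtain p where "p \<in> topspace X" by blast
      then show ?thesis using \<open>\<And>p q. _ \<Longrightarrow> _ \<Longrightarrow> f p = f q\<close> \<open>\<forall>p\<in>_. f p \<noteq> 0\<close>
        by (intro that[of "f p"]) blast+
    qed
    have "\<alpha> x p = (\<lambda>v. c * \<eta> x p v)" if "x \<in> A" "p \<in> fst x" for x p
    proof -
      have "f p = c" using c(2) sub that by blast
      then show ?thesis using \<open>diff_form_eq A \<alpha> _\<close> that by (simp add: diff_form_eq_def)
    qed
    then show ?thesis using c(1) by (intro exI[of _ c]) (auto simp: diff_form_eq_def)
  qed
  show ?thesis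
  proof (intro conjI impI)
    assume "coupled X A \<omega> \<psi>"
    then obtain f where f: "smooth_function A f" "\<forall>p\<in>topspace X. f p \<noteq> 0"
        "diff_form_eq A (ext_deriv 2 \<omega>) (\<lambda>c p v. f p * \<psi> c p v)"
      and d\<psi>: "diff_form_eq A (ext_deriv (Suc 2) \<psi>) (\<lambda>_ _ _. 0)"
      by (auto simp: coupled_def half_flat_def)
    have "f p = f q" if "p \<in> topspace X" "q \<in> topspace X" for p q
    proof (rule coefficient_constant[where \<alpha> = \<omega> and \<eta> = \<psi> and k = 2, OF M assms(2) f(1) _ _ f(3) d\<psi>])
      show "a u = 0" if "c \<in> A" "p \<in> fst c" "linear a" "\<And>v. covector_wedge (Suc 2) a (\<psi> c p) v = 0"
        for c p a u
        using covector_wedge_psi_injective[OF alt tamed] that by auto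
    qed (use \<omega> \<psi> that in auto)
    then show "\<exists>c::real. c \<noteq> 0 \<and> diff_form_eq A (ext_deriv 2 \<omega>) (\<lambda>x p v. c * \<psi> x p v)"
      using f(2,3) by (rule const)
  next
    assume "double X A \<omega> \<psi>"
    then obtain f where f: "smooth_function A f" "\<forall>p\<in>topspace X. f p \<noteq> 0"
        "diff_form_eq A (ext_deriv 3 (psi_minus \<omega> \<psi>)) (\<lambda>c p v. f p * omega_squared \<omega> c p v)"
      and d\<omega>2: "diff_form_eq A (ext_deriv (Suc 3) (omega_squared \<omega>)) (\<lambda>_ _ _. 0)"
      by (auto simp: double_def half_flat_def)
    have "f p = f q" if "p \<in> topspace X" "q \<in> topspace X" for p q
    proof (rule coefficient_constant[where \<alpha> = "psi_minus \<omega> \<psi>" and \<eta> = "omega_squared \<omega>" and k = 3,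
          OF M assms(2) f(1) _ _ f(3) d\<omega>2])
      show "a u = 0" if "c \<in> A" "p \<in> fst c" "linear a"
        "\<And>v. covector_wedge (Suc 3) a (omega_squared \<omega> c p) v = 0" for c p a u
        using tamed.covector_wedge_square_injective[OF tamed] that by (auto simp: omega_squared_def)
    qed (use \<psi>_minus \<omega>2 that in auto)
    then show "\<exists>k::real. k \<noteq> 0 \<and>
        diff_form_eq A (ext_deriv 3 (psi_minus \<omega> \<psi>)) (\<lambda>x p v. k * omega_squared \<omega> x p v)"
      using f(2,3) by (rule const)
  qed
qed

end
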